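(* Let $G$ be an abundant graph with order $n$ and minimum degree $\delta$. Then $\mathrm{gp}(\mathcal{M}(G))=n+\mathrm{ip}_4(G)-\delta+1$ if and only if $V(G)$ can be partitioned into three sets $V_1$, $V_2$ and $V_4$ such that (i) $|V_1|=|V_2|>|V_4|=\delta-1$; (ii) $V_1$ is an independent set; (iii) $(V_1,V_2)$ is a matching; (iv) the vertices of $V_2$ have degree at least $\delta$; and (v) any vertex of $V_2$ that is not universal in the subgraph $\langle V_2\rangle$ of $G$ induced by $V_2$ has an edge to $V_4$.
   Context: All graphs are simple, connected and finite. A set $S$ of vertices of a graph $H$ is a general position set if no shortest path in $H$ contains three or more vertices of $S$; $\mathrm{gp}(H)$ is the number of vertices in a largest general position set of $H$. The Mycielskian $\mathcal{M}(G)$ of a graph $G$ with vertex set $V$ and edge set $E$ has vertex set $V\cup V'\cup\{u^*\}$, where $V'=\{u' : u\in V\}$ is a disjoint copy of $V$ and $u^*$ is an additional vertex (the root), and edge set $E\cup\{uv' : uv\in E\}\cup\{v'u^* : v'\in V'\}$ (for each edge $uv\in E$ both $uv'$ and $vu'$ are included). An independent $4$-position set of $G$ is a subset $S\subseteq V(G)$ that is an independent set and such that no shortest path of $G$ of length at most $4$ passes through three or more vertices of $S$; $\mathrm{ip}_4(G)$ is the largest number of vertices in such a set. A non-complete graph $G$ with order $n\geq 3$ is meagre if $\mathrm{gp}(\mathcal{M}(G))=\max\{n,2\,\mathrm{ip}_4(G)\}$ and abundant otherwise, i.e. if $\mathrm{gp}(\mathcal{M}(G))>\max\{n,2\,\mathrm{ip}_4(G)\}$.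 $(V_1,V_2)$ denotes the set of edges of $G$ with one endpoint in $V_1$ and the other in $V_2$; a matching is a set of edges no two of which share an endpoint. A vertex of a graph is universal if it is adjacent to all other vertices of that graph. *)

theory Defs
  imports Graph_Theory.Graph_Theory
begin

text \<open>
  A simple finite graph is a symmetric loop-free digraph: each undirected edge is a pair of
  opposite arcs, so the degree of a vertex is its out-degree.
\<close>

definition shortest_path :: "('a, 'b) pre_digraph \<Rightarrow> 'a \<Rightarrow> 'b awalk \<Rightarrow> 'a \<Rightarrow> bool" where
  "shortest_path H u p v \<longleftrightarrow>
     pre_digraph.apath H u p v \<and> (\<forall>q. pre_digraph.apath H u q v \<longrightarrow> length p \<le> length q)"

definition general_position :: "('a, 'b) pre_digraph \<Rightarrow> 'a set \<Rightarrow> bool" where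
  "general_position H S \<longleftrightarrow> S \<subseteq> verts H \<and>
     \<not> (\<exists>u p v. shortest_path H u p v \<and> card (S \<inter> set (pre_digraph.awalk_verts H u p)) \<ge> 3)"

definition gp :: "('a, 'b) pre_digraph \<Rightarrow> nat" where
  "gp H = Max (card ` {S. general_position H S})"

definition independent_set :: "('a, 'b) pre_digraph \<Rightarrow> 'a set \<Rightarrow> bool" where
  "independent_set H S \<longleftrightarrow> S \<subseteq> verts H \<and> (\<forall>u \<in> S. \<forall>v \<in> S. \<not> u \<rightarrow>\<^bsub>H\<^esub> v)"

definition independent_position :: "nat \<Rightarrow> ('a, 'b) pre_digraph \<Rightarrow> 'a set \<Rightarrow> bool" where
  "independent_position k H S \<longleftrightarrow> independent_set H S \<and>
     \<not> (\<exists>u p v. shortest_path H u p v \<and> length p \<le> k \<and>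
                card (S \<inter> set (pre_digraph.awalk_verts H u p)) \<ge> 3)"

definition ip :: "nat \<Rightarrow> ('a, 'b) pre_digraph \<Rightarrow> nat" where
  "ip k H = Max (card ` {S. independent_position k H S})"

definition min_degree :: "('a, 'b) pre_digraph \<Rightarrow> nat" where
  "min_degree H = Min (out_degree H ` verts H)"

datatype 'a myc_vertex = Orig 'a | Twin 'a | Root

definition Mycielskian :: "'a pair_pre_digraph \<Rightarrow> 'a myc_vertex pair_pre_digraph" where
  "Mycielskian G =
    \<lparr> pverts = Orig ` pverts G \<union> Twin ` pverts G \<union> {Root},
      parcs = {(Orig u, Orig v) | u v. (u, v) \<in> parcs G}
            \<union> {(Orig u, Twin v) | u v. (u, v) \<in> parcs G}
            \<union> {(Twin v, Orig u) | u v. (u, v) \<in> parcs G}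
            \<union> {(Twin v, Root) | v. v \<in> pverts G}
            \<union> {(Root, Twin v) | v. v \<in> pverts G} \<rparr>"

definition abundant :: "'a pair_pre_digraph \<Rightarrow> bool" where
  "abundant G \<longleftrightarrow>
     \<not> complete_digraph (card (pverts G)) (with_proj G) \<and>
     card (pverts G) \<ge> 3 \<and>
     gp (with_proj (Mycielskian G)) > max (card (pverts G)) (2 * ip 4 (with_proj G))"

definition edges_between :: "('a, 'b) pre_digraph \<Rightarrow> 'a set \<Rightarrow> 'a set \<Rightarrow> 'a set set" where
  "edges_between H A B = {{u, v} | u v. u \<in> A \<and> v \<in> B \<and> u \<rightarrow>\<^bsub>H\<^esub> v}"

definition is_matching :: "'a set set \<Rightarrow> bool" where
  "is_matching M \<longleftrightarrow> (\<forall>e \<in> M. \<forall>f \<in> M. e \<noteq> f \<longrightarrow> e \<inter> f = {})"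

definition universal_vertex :: "('a, 'b) pre_digraph \<Rightarrow> 'a \<Rightarrow> bool" where
  "universal_vertex H v \<longleftrightarrow> v \<in> verts H \<and> (\<forall>u \<in> verts H - {v}. v \<rightarrow>\<^bsub>H\<^esub> u)"

end

theory Submission
  imports Defs
begin

text \<open>
  Write \<open>n\<close> for the order, \<open>\<delta>\<close> for the minimum degree and \<open>M\<close> for the Mycielskian. A set \<open>S\<close> of
  vertices of \<open>M\<close> sorts the vertices \<open>v\<close> of \<open>G\<close> into four classes, according to which of \<open>v\<close> and its
  twin \<open>v'\<close> lie in \<open>S\<close>: both (\<open>V1\<close>), only the twin (\<open>V2\<close>), only the original (\<open>V3\<close>), or none
  (\<open>V4\<close>). If the root is not in \<open>S\<close>, then \<open>|S| = n + |V1| - |V4|\<close>.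

  Suppose that \<open>S\<close> is in general position and has more than \<open>n\<close> elements. If the root belongs to \<open>S\<close>,
  at most one twin does, and \<open>|S| \<le> n + 2 - \<delta>\<close>, which is less than \<open>n + ip\<^sub>4 - \<delta> + 1\<close> because a
  connected non-complete graph has \<open>ip\<^sub>4 \<ge> 2\<close> (\<open>Root_card_le\<close>, \<open>two_le_ip\<close>). Otherwise \<open>V1\<close> is an
  independent 4-position set, since distances up to 4 are the same in \<open>G\<close> and between the originals
  in \<open>M\<close>. A neighbour \<open>w\<close> of \<open>u \<in> V1\<close> cannot lie in \<open>S\<close> as an original, because \<open>u, w, u'\<close> would be a
  geodesic, and at most one neighbour contributes its twin, because \<open>v', u, w'\<close> would be a geodesic.
  Hence \<open>|V4| \<ge> \<delta> - 1\<close> and \<open>|S| \<le> n + ip\<^sub>4 - \<delta> + 1\<close> (\<open>gp_set_card_bound\<close>).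

  Equality forces \<open>|V1| = ip\<^sub>4\<close> and \<open>|V4| = \<delta> - 1\<close>. Then every \<open>u \<in> V1\<close> is adjacent to all of \<open>V4\<close> and to
  exactly one vertex of \<open>V2\<close>, its mate, and different vertices have different mates. The set \<open>V4\<close> is not empty, so
  \<open>V1\<close> has pairwise distances 2. Every further vertex at distance 2 from all of \<open>V1\<close> would therefore
  enlarge the maximal set \<open>V1\<close> (\<open>both_in_maximal\<close>). This excludes vertices of \<open>V2\<close> that are nobody's
  mate, and, by connectedness, it excludes \<open>V3\<close> altogether. Property (v) expresses that the path
  \<open>u, m', root, w'\<close>, where \<open>m\<close> is the mate of \<open>u\<close>, must not be a geodesic.

  Conversely, given a partition, the same degree count shows that every vertex of \<open>V1\<close> sees all of
  \<open>V4\<close> and one partner in \<open>V2\<close>. If \<open>\<delta> \<ge> 2\<close>, the set formed by \<open>V1\<close> and the twins of \<open>V1 \<union> V2\<close> has pairwise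
  distances at most 2, and its only edges join a vertex of \<open>V1\<close> to the twin of its partner; so no three
  of its vertices share a geodesic. It has \<open>n + |V1| - |V4|\<close> elements, and no independent set of \<open>G\<close> is
  larger than \<open>V1\<close>. If \<open>\<delta> = 1\<close>, then \<open>G\<close> is a clique with one pendant vertex attached to each of its
  vertices. In its Mycielskian a general position set has at most \<open>n\<close> elements (\<open>corona_card_le\<close>), so
  \<open>G\<close> is not abundant.
\<close>

section \<open>Vertices on a common geodesic\<close>

text \<open>
  Walks enter only through their lengths, so a vertex \<open>b\<close> on a geodesic from \<open>a\<close> to \<open>c\<close> is described
  by powers of the adjacency relation: two walks via \<open>b\<close> of total length \<open>l\<close>, and no shorter walk from
  \<open>a\<close> to \<open>c\<close>. The inequality of \<open>a\<close> and \<open>c\<close> follows.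
\<close>
definition geodesic_through :: "'a rel \<Rightarrow> 'a \<Rightarrow> 'a \<Rightarrow> 'a \<Rightarrow> nat \<Rightarrow> bool" where
  "geodesic_through R a b c l \<longleftrightarrow> a \<noteq> b \<and> b \<noteq> c \<and>
     (\<exists>i j. l = i + j \<and> (a, b) \<in> R ^^ i \<and> (b, c) \<in> R ^^ j) \<and> (\<forall>m<l. (a, c) \<notin> R ^^ m)"

lemma geodesic_through_ends_neq:
  assumes "geodesic_through R a b c l"
  shows "a \<noteq> c"
proof
  assume "a = c"
  then have "(a, c) \<in> R ^^ 0" by simp
  then have "l = 0" using assms unfolding geodesic_through_def by (metis gr0I)
  then show False using assms unfolding geodesic_through_def by auto
qed

lemma split_list_three:
  assumes "card (S \<inter> set xs) \<ge> 3" and "distinct xs"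
  obtains ws a xs' b ys c zs where "xs = ws @ a # xs' @ b # ys @ c # zs"
    and "a \<in> S" "b \<in> S" "c \<in> S"
proof -
  let ?f = "filter (\<lambda>x. x \<in> S) xs"
  have "set ?f = S \<inter> set xs" by auto
  then have "length ?f \<ge> 3"
    using assms by (metis distinct_card distinct_filter)
  then obtain a b c r where f: "?f = a # b # c # r"
    by (cases ?f; cases "tl ?f"; cases "tl (tl ?f)") auto
  from filter_eq_ConsD[OF f] obtain ws xs1 where 1: "xs = ws @ a # xs1" "a \<in> S"
    "b # c # r = filter (\<lambda>x. x \<in> S) xs1" by auto
  from filter_eq_ConsD[OF 1(3)[symmetric]] obtain ys1 xs2 where 2: "xs1 = ys1 @ b # xs2" "b \<in> S"
    "c # r = filter (\<lambda>x. x \<in> S) xs2" by auto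
  from filter_eq_ConsD[OF 2(3)[symmetric]] obtain ys2 xs3 where 3: "xs2 = ys2 @ c # xs3" "c \<in> S"
    by auto
  show thesis using that 1 2 3 by simp
qed

context wf_digraph
begin

lemma awalk_iff_relpow:
  assumes "u \<in> verts G"
  shows "(\<exists>p. awalk u p v \<and> length p = k) \<longleftrightarrow> (u, v) \<in> arcs_ends G ^^ k"
  using assms
proof (induction k arbitrary: u)
  case 0
  then show ?case by (auto simp: awalk_Nil_iff)
next
  case (Suc k)
  show ?case
  proof
    assume "\<exists>p. awalk u p v \<and> length p = Suc k"
    then obtain e es where e: "awalk u (e # es) v" "length es = k"
      by (metis length_Suc_conv)
    then have "(u, head G e) \<in> arcs_ends G" "awalk (head G e) es v"
      by (auto simp: awalk_Cons_iff arcs_ends_conv)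
    then show "(u, v) \<in> arcs_ends G ^^ Suc k"
      using Suc.IH[of "head G e"] e(2) by (metis awalk_hd_in_verts relpow_Suc_I2)
  next
    assume "(u, v) \<in> arcs_ends G ^^ Suc k"
    then obtain w where w: "(u, w) \<in> arcs_ends G" "(w, v) \<in> arcs_ends G ^^ k"
      by (metis relpow_Suc_D2)
    then obtain e where e: "e \<in> arcs G" "tail G e = u" "head G e = w"
      by (auto simp: arcs_ends_conv)
    then obtain es where "awalk w es v" "length es = k"
      using Suc.IH[of w] w(2) wellformed by auto
    then have "awalk u (e # es) v \<and> length (e # es) = Suc k"
      using e by (auto simp: awalk_Cons_iff)
    then show "\<exists>p. awalk u p v \<and> length p = Suc k" by blast
  qed
qed

lemma relpow_if_awalk: "awalk u p v \<Longrightarrow> (u, v) \<in> arcs_ends G ^^ length p"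
  using awalk_iff_relpow awalk_hd_in_verts by blast

lemma apath_if_no_shorter_walk:
  assumes "awalk u p v" and min: "\<And>m. m < length p \<Longrightarrow> (u, v) \<notin> arcs_ends G ^^ m"
  shows "apath u p v"
proof -
  have "distinct (awalk_verts u p)"
  proof (rule ccontr)
    assume "\<not> ?thesis"
    from awalk_not_distinct_decomp[OF assms(1) this]
    obtain q r s w where *: "p = q @ r @ s" "0 < length r" "awalk u q w" "awalk w s v"
      by auto
    then have "awalk u (q @ s) v" by auto
    then have "(u, v) \<in> arcs_ends G ^^ length (q @ s)" by (rule relpow_if_awalk)
    then show False using min[of "length (q @ s)"] *(1,2) by simp
  qed
  then show ?thesis using assms(1) by (simp add: apath_def)
qed

lemma shortest_path_iff_relpow:
  "shortest_path G u p v \<longleftrightarrow> awalk u p v \<and> (\<forall>m<length p. (u, v) \<notin> arcs_ends G ^^ m)"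
proof
  assume sp: "shortest_path G u p v"
  then have aw: "awalk u p v" by (auto simp: shortest_path_def apath_def)
  define k where "k = (LEAST m. (u, v) \<in> arcs_ends G ^^ m)"
  have "(u, v) \<in> arcs_ends G ^^ k"
    unfolding k_def using relpow_if_awalk[OF aw] by (rule LeastI)
  then obtain q where q: "awalk u q v" "length q = k"
    using awalk_iff_relpow aw awalk_hd_in_verts by blast
  have min: "(u, v) \<notin> arcs_ends G ^^ m" if "m < k" for m
    using that not_less_Least unfolding k_def by blast
  have "apath u q v" using apath_if_no_shorter_walk q min by blast
  then have "length p \<le> k" using sp q(2) unfolding shortest_path_def by blast
  then show "awalk u p v \<and> (\<forall>m<length p. (u, v) \<notin> arcs_ends G ^^ m)" using aw min by auto
next
  assume R: "awalk u p v \<and> (\<forall>m<length p. (u, v) \<notin> arcs_ends G ^^ m)"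
  have "length p \<le> length q" if "apath u q v" for q
    using R relpow_if_awalk that unfolding apath_def by (meson not_le)
  then show "shortest_path G u p v"
    using R apath_if_no_shorter_walk by (auto simp: shortest_path_def)
qed

text \<open>
  A shortest path through three vertices of \<open>S\<close> can be cut down to one that starts and ends in \<open>S\<close>,
  because subpaths of shortest paths are shortest. This reduces general position to a condition on
  triples of vertices, and the length bound survives because the path only gets shorter.
\<close>
lemma shortest_path_meets_thrice_iff:
  assumes "S \<subseteq> verts G"
  shows "(\<exists>u p v. shortest_path G u p v \<and> length p \<le> k \<and> card (S \<inter> set (awalk_verts u p)) \<ge> 3)
    \<longleftrightarrow> (\<exists>a\<in>S. \<exists>b\<in>S. \<exists>c\<in>S. \<exists>l\<le>k. geodesic_through (arcs_ends G) a b c l)"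
proof
  assume "\<exists>u p v. shortest_path G u p v \<and> length p \<le> k \<and> card (S \<inter> set (awalk_verts u p)) \<ge> 3"
  then obtain u p v where sp: "shortest_path G u p v" "length p \<le> k"
    and card: "card (S \<inter> set (awalk_verts u p)) \<ge> 3" by blast
  then have dist: "distinct (awalk_verts u p)" by (auto simp: shortest_path_def apath_def)
  from split_list_three[OF card dist] obtain ws a xs b ys c zs
    where dec: "awalk_verts u p = ws @ a # xs @ b # ys @ c # zs" and S: "a \<in> S" "b \<in> S" "c \<in> S" .
  have aw: "awalk u p v" and min: "\<And>m. m < length p \<Longrightarrow> (u, v) \<notin> arcs_ends G ^^ m"
    using sp by (auto simp: shortest_path_iff_relpow)
  have "cas u p v" using aw by auto
  then obtain q r where 1: "cas u q a" "cas a r v" "p = q @ r" "awalk_verts a r = (a # xs) @ b # ys @ c # zs"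
    using dec by (elim awalk_decomp_verts[of u p v ws a "xs @ b # ys @ c # zs"]) auto
  obtain r1 s where 2: "cas a r1 b" "cas b s v" "r = r1 @ s" "awalk_verts b s = (b # ys) @ c # zs"
    using 1(4) by (elim awalk_decomp_verts[OF 1(2)]) auto
  obtain r2 t where 3: "cas b r2 c" "cas c t v" "s = r2 @ t"
    by (rule awalk_decomp_verts[OF 2(2,4)]) auto
  have in_V: "a \<in> verts G" "b \<in> verts G" "c \<in> verts G" using S assms by auto
  have arcs: "set p \<subseteq> arcs G" "u \<in> verts G" using aw by (auto simp: awalk_def)
  have w: "awalk u q a" "awalk a r1 b" "awalk b r2 c" "awalk c t v"
    using 1 2 3 in_V arcs by (auto simp: awalk_def)
  have "(a, c) \<notin> arcs_ends G ^^ m" if m: "m < length r1 + length r2" for m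
  proof
    assume "(a, c) \<in> arcs_ends G ^^ m"
    then obtain r' where "awalk a r' c" "length r' = m" using awalk_iff_relpow in_V by blast
    \<comment> \<open>A shortcut between \<open>a\<close> and \<open>c\<close> would shorten the whole path.\<close>
    then have "awalk u (q @ r' @ t) v" using w by auto
    then have "(u, v) \<in> arcs_ends G ^^ length (q @ r' @ t)" by (rule relpow_if_awalk)
    moreover have "length (q @ r' @ t) < length p" using m \<open>length r' = m\<close> 1(3) 2(3) 3(3) by simp
    ultimately show False using min by blast
  qed
  moreover have "a \<noteq> b" "b \<noteq> c" using dist dec by auto
  ultimately have "geodesic_through (arcs_ends G) a b c (length r1 + length r2)"
    using relpow_if_awalk w unfolding geodesic_through_def by blast
  moreover have "length r1 + length r2 \<le> k" using 1(3) 2(3) 3(3) sp by auto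
  ultimately show "\<exists>a\<in>S. \<exists>b\<in>S. \<exists>c\<in>S. \<exists>l\<le>k. geodesic_through (arcs_ends G) a b c l"
    using S by blast
next
  assume "\<exists>a\<in>S. \<exists>b\<in>S. \<exists>c\<in>S. \<exists>l\<le>k. geodesic_through (arcs_ends G) a b c l"
  then obtain a b c l where S: "a \<in> S" "b \<in> S" "c \<in> S" "l \<le> k"
    and g: "geodesic_through (arcs_ends G) a b c l" by blast
  have in_V: "a \<in> verts G" "b \<in> verts G" "c \<in> verts G" using S assms by auto
  obtain i j where ij: "l = i + j" "(a, b) \<in> arcs_ends G ^^ i" "(b, c) \<in> arcs_ends G ^^ j"
    using g unfolding geodesic_through_def by blast
  obtain p q where p: "awalk a p b" "length p = i" and q: "awalk b q c" "length q = j"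
    using ij in_V awalk_iff_relpow by meson
  have aw: "awalk a (p @ q) c" using p q by auto
  have "shortest_path G a (p @ q) c"
    using aw g p q ij(1) unfolding shortest_path_iff_relpow geodesic_through_def by auto
  moreover have "{a, b, c} \<subseteq> S \<inter> set (awalk_verts a (p @ q))"
  proof -
    have "c \<in> set (awalk_verts b q)"
      using q(1) last_in_set[OF awalk_verts_non_Nil, of b q] by auto
    then show ?thesis
      using S set_awalk_verts_append[OF p(1) q(1)] hd_in_awalk_verts(1)[OF p(1)]
        hd_in_awalk_verts(1)[OF q(1)] by blast
  qed
  then have "card {a, b, c} \<le> card (S \<inter> set (awalk_verts a (p @ q)))"
    by (intro card_mono) auto
  then have "card (S \<inter> set (awalk_verts a (p @ q))) \<ge> 3"
    using g geodesic_through_ends_neq[OF g] by (auto simp: geodesic_through_def)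
  ultimately show "\<exists>u p v. shortest_path G u p v \<and> length p \<le> k \<and> card (S \<inter> set (awalk_verts u p)) \<ge> 3"
    using S(4) p(2) q(2) ij(1) by (intro exI[of _ a] exI[of _ "p @ q"] exI[of _ c]) simp
qed

lemma general_position_iff:
  "general_position G S \<longleftrightarrow> S \<subseteq> verts G \<and>
     (\<forall>a\<in>S. \<forall>b\<in>S. \<forall>c\<in>S. \<forall>l. \<not> geodesic_through (arcs_ends G) a b c l)"
proof (cases "S \<subseteq> verts G")
  case True
  have "(\<exists>u p v. shortest_path G u p v \<and> card (S \<inter> set (awalk_verts u p)) \<ge> 3)
    \<longleftrightarrow> (\<exists>k u p v. shortest_path G u p v \<and> length p \<le> k \<and> card (S \<inter> set (awalk_verts u p)) \<ge> 3)"
    by blast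
  also have "\<dots> \<longleftrightarrow> (\<exists>k. \<exists>a\<in>S. \<exists>b\<in>S. \<exists>c\<in>S. \<exists>l\<le>k. geodesic_through (arcs_ends G) a b c l)"
    using shortest_path_meets_thrice_iff[OF True] by simp
  also have "\<dots> \<longleftrightarrow> (\<exists>a\<in>S. \<exists>b\<in>S. \<exists>c\<in>S. \<exists>l. geodesic_through (arcs_ends G) a b c l)"
    by blast
  finally show ?thesis unfolding general_position_def using True by blast
qed (simp add: general_position_def)

lemma independent_position_iff:
  "independent_position k G S \<longleftrightarrow> independent_set G S \<and>
     (\<forall>a\<in>S. \<forall>b\<in>S. \<forall>c\<in>S. \<forall>l\<le>k. \<not> geodesic_through (arcs_ends G) a b c l)"
  using shortest_path_meets_thrice_iff[of S k]
  unfolding independent_position_def independent_set_def by blast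

end

text \<open>
  With pairwise distances at most 2, the middle one of three vertices on a geodesic is adjacent to both
  others, so it suffices to exclude paths with two edges inside \<open>S\<close>.
\<close>
lemma no_geodesic_through_diameter_2:
  assumes diam: "\<And>a c. \<lbrakk>a \<in> S; c \<in> S; a \<noteq> c; (a, c) \<notin> R\<rbrakk> \<Longrightarrow> \<exists>x. (a, x) \<in> R \<and> (x, c) \<in> R"
    and no_P3: "\<And>a b c. \<lbrakk>a \<in> S; b \<in> S; c \<in> S; (a, b) \<in> R; (b, c) \<in> R\<rbrakk> \<Longrightarrow> a = c"
    and "a \<in> S" "b \<in> S" "c \<in> S"
  shows "\<not> geodesic_through R a b c l"
proof
  assume g: "geodesic_through R a b c l"
  then obtain i j where ij: "l = i + j" "(a, b) \<in> R ^^ i" "(b, c) \<in> R ^^ j"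
    and min: "\<And>m. m < l \<Longrightarrow> (a, c) \<notin> R ^^ m" and neq: "a \<noteq> b" "b \<noteq> c"
    unfolding geodesic_through_def by blast
  have ac: "a \<noteq> c" using geodesic_through_ends_neq[OF g] .
  have "i \<noteq> 0" "j \<noteq> 0" using ij neq by (auto intro!: gr0I)
  moreover have "l \<le> 2"
  proof (rule ccontr)
    assume "\<not> l \<le> 2"
    then have "(a, c) \<notin> R ^^ 1" "(a, c) \<notin> R ^^ 2" using min[of 1] min[of 2] by linarith+
    then show False using diam[OF assms(3,5) ac] by (auto simp: numeral_2_eq_2)
  qed
  ultimately have "i = 1" "j = 1" using ij(1) by auto
  then show False using ij no_P3 assms(3-5) ac by auto
qed

lemma geodesic_through_P3I:
  assumes "(a, b) \<in> R" "(b, c) \<in> R" "(a, c) \<notin> R" "a \<noteq> c" "a \<noteq> b" "b \<noteq> c"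
  shows "geodesic_through R a b c 2"
proof -
  have "(a, c) \<notin> R ^^ m" if "m < 2" for m
    using assms that by (auto simp: less_2_cases_iff)
  then show ?thesis using assms unfolding geodesic_through_def
    by (auto intro!: exI[of _ "1::nat"])
qed

text \<open>
  The two middle vertices play different roles: only \<open>b\<close> is counted, and \<open>x\<close> may lie outside the set
  under consideration.
\<close>
lemma geodesic_through_P4I:
  assumes "(a, b) \<in> R" "(b, x) \<in> R" "(x, c) \<in> R" "a \<noteq> b"
    and "(a, c) \<notin> R" "a \<noteq> c" "\<And>y. (a, y) \<in> R \<Longrightarrow> (y, c) \<notin> R"
  shows "geodesic_through R a b c 3"
proof -
  have "(a, c) \<notin> R ^^ m" if "m < 3" for m
  proof -
    have "m = 0 \<or> m = 1 \<or> m = 2" using that by linarith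
    then show ?thesis using assms by (auto simp: numeral_2_eq_2)
  qed
  moreover have "(b, c) \<in> R ^^ 2" using assms by (auto simp: numeral_2_eq_2)
  moreover have "b \<noteq> c" using assms by auto
  moreover have "(a, b) \<in> R ^^ 1" "(3::nat) = 1 + 2" using assms(1) by simp_all
  ultimately show ?thesis using assms(4) unfolding geodesic_through_def by blast
qed

section \<open>General position sets of a Mycielskian\<close>

lemma Mycielskian_pverts:
  "pverts (Mycielskian G) = Orig ` pverts G \<union> Twin ` pverts G \<union> {Root}"
  by (simp add: Mycielskian_def)

lemma Mycielskian_parcs [simp]:
  "(Orig u, Orig v) \<in> parcs (Mycielskian G) \<longleftrightarrow> (u, v) \<in> parcs G"
  "(Orig u, Twin v) \<in> parcs (Mycielskian G) \<longleftrightarrow> (u, v) \<in> parcs G"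
  "(Twin v, Orig u) \<in> parcs (Mycielskian G) \<longleftrightarrow> (u, v) \<in> parcs G"
  "(Twin v, Root) \<in> parcs (Mycielskian G) \<longleftrightarrow> v \<in> pverts G"
  "(Root, Twin v) \<in> parcs (Mycielskian G) \<longleftrightarrow> v \<in> pverts G"
  "(Twin u, Twin v) \<notin> parcs (Mycielskian G)"
  "(Orig u, Root) \<notin> parcs (Mycielskian G)"
  "(Root, Orig u) \<notin> parcs (Mycielskian G)"
  "(Root, Root) \<notin> parcs (Mycielskian G)"
  by (auto simp: Mycielskian_def)

lemma ex_myc_vertex: "(\<exists>x. P x) \<longleftrightarrow> (\<exists>v. P (Orig v)) \<or> (\<exists>v. P (Twin v)) \<or> P Root"
  by (metis myc_vertex.exhaust)

definition both_in :: "'a myc_vertex set \<Rightarrow> 'a set" where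
  "both_in S = {v. Orig v \<in> S \<and> Twin v \<in> S}"

definition twin_only :: "'a myc_vertex set \<Rightarrow> 'a set" where
  "twin_only S = {v. Orig v \<notin> S \<and> Twin v \<in> S}"

definition none_in :: "'a pair_pre_digraph \<Rightarrow> 'a myc_vertex set \<Rightarrow> 'a set" where
  "none_in G S = {v \<in> pverts G. Orig v \<notin> S \<and> Twin v \<notin> S}"

context pair_graph
begin

lemma arcs_irrefl [simp]: "(u, u) \<notin> parcs G"
  using pair_no_loops by fastforce

lemma pair_graph_Mycielskian: "pair_graph (Mycielskian G)"
proof
  show "finite (parcs (Mycielskian G))"
  proof (rule finite_subset)
    show "parcs (Mycielskian G) \<subseteq> pverts (Mycielskian G) \<times> pverts (Mycielskian G)"
      by (auto simp: Mycielskian_def dest: in_arcsD1 in_arcsD2)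
    show "finite (pverts (Mycielskian G) \<times> pverts (Mycielskian G))"
      by (simp add: Mycielskian_pverts)
  qed
qed (auto simp: Mycielskian_def symmetric_def dest: in_arcsD1 in_arcsD2 intro!: symI intro: arcs_symmetric)

lemma general_position_Mycielskian_iff:
  "general_position (with_proj (Mycielskian G)) S \<longleftrightarrow> S \<subseteq> pverts (Mycielskian G) \<and>
     (\<forall>a\<in>S. \<forall>b\<in>S. \<forall>c\<in>S. \<forall>l. \<not> geodesic_through (parcs (Mycielskian G)) a b c l)"
proof -
  interpret M: pair_graph "Mycielskian G" by (rule pair_graph_Mycielskian)
  show ?thesis by (rule M.general_position_iff)
qed

lemma out_degree_eq: "out_degree (with_proj G) u = card {v. (u, v) \<in> parcs G}"
proof -
  have "out_arcs (with_proj G) u = Pair u ` {v. (u, v) \<in> parcs G}"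
    by (auto simp: out_arcs_def)
  then show ?thesis unfolding out_degree_def by (simp add: card_image inj_on_def)
qed

lemma finite_nbrs [simp]: "finite {v. (u, v) \<in> parcs G}"
  by (rule finite_subset[of _ "pverts G"]) (auto dest: in_arcsD2)

lemma min_degree_le_nbrs:
  "u \<in> pverts G \<Longrightarrow> min_degree (with_proj G) \<le> card {v. (u, v) \<in> parcs G}"
  unfolding min_degree_def out_degree_eq[symmetric] by (intro Min_le) auto

lemma finite_general_positions: "finite {S. general_position (with_proj (Mycielskian G)) S}"
proof (rule finite_subset)
  interpret M: pair_graph "Mycielskian G" by (rule pair_graph_Mycielskian)
  show "finite (Pow (pverts (Mycielskian G)))" using M.pair_finite_verts by simp
  show "{S. general_position (with_proj (Mycielskian G)) S} \<subseteq> Pow (pverts (Mycielskian G))"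
    by (auto simp: general_position_Mycielskian_iff)
qed

lemma card_le_gp_Mycielskian:
  "general_position (with_proj (Mycielskian G)) S \<Longrightarrow> card S \<le> gp (with_proj (Mycielskian G))"
  unfolding gp_def using finite_general_positions by (intro Max_ge) auto

lemma gp_Mycielskian_attained:
  obtains S where "general_position (with_proj (Mycielskian G)) S"
    "card S = gp (with_proj (Mycielskian G))"
proof -
  have "general_position (with_proj (Mycielskian G)) {}"
    by (simp add: general_position_Mycielskian_iff)
  then have "gp (with_proj (Mycielskian G))
      \<in> card ` {S. general_position (with_proj (Mycielskian G)) S}"
    unfolding gp_def using finite_general_positions by (intro Max_in) auto
  then show thesis using that by auto
qed

lemma finite_independent_positions: "finite {S. independent_position k (with_proj G) S}"
  by (rule finite_subset[of _ "Pow (pverts G)"])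
    (auto simp: independent_position_def independent_set_def)

lemma card_le_ip: "independent_position k (with_proj G) S \<Longrightarrow> card S \<le> ip k (with_proj G)"
  unfolding ip_def using finite_independent_positions by (intro Max_ge) auto

lemma ip_le:
  assumes "\<And>S. independent_position k (with_proj G) S \<Longrightarrow> card S \<le> m"
  shows "ip k (with_proj G) \<le> m"
proof -
  have "independent_position k (with_proj G) {}"
    by (simp add: independent_position_iff independent_set_def)
  then show ?thesis
    unfolding ip_def using finite_independent_positions assms by (subst Max_le_iff) auto
qed

text \<open>
  The counting step behind both directions: when all neighbours of \<open>u\<close> but at most one must come
  from a set \<open>B\<close> of only \<open>\<delta> - 1\<close> vertices, the degree bound leaves no slack, so \<open>u\<close> sees all of
  \<open>B\<close> and exactly one further vertex.
\<close>
lemma nbrs_eq_insert: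
  assumes "u \<in> pverts G" and sub: "{w. (u, w) \<in> parcs G} \<subseteq> A \<union> B"
    and 1: "card ({w. (u, w) \<in> parcs G} \<inter> A) \<le> 1"
    and "finite B" and card_B: "card B + 1 = min_degree (with_proj G)"
  shows "\<exists>v\<in>A. {w. (u, w) \<in> parcs G} = insert v B"
proof -
  let ?N = "{w. (u, w) \<in> parcs G}"
  have N: "?N = (?N \<inter> A) \<union> (?N \<inter> B)"
    by (rule inf.absorb1[OF sub, symmetric, unfolded Int_Un_distrib])
  have 2: "card (?N \<inter> B) \<le> card B" by (intro card_mono \<open>finite B\<close> Int_lower2)
  have "min_degree (with_proj G) \<le> card ?N"
    using min_degree_le_nbrs assms(1) .
  also have "card ?N \<le> card (?N \<inter> A) + card (?N \<inter> B)"
    using N card_Un_le[of "?N \<inter> A" "?N \<inter> B"] by simp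
  finally have c: "card (?N \<inter> A) = 1" "card (?N \<inter> B) = card B" using 1 2 card_B by linarith+
  obtain v where v: "?N \<inter> A = {v}" using c(1) by (rule card_1_singletonE)
  have "?N \<inter> B = B" using c(2) by (intro card_subset_eq \<open>finite B\<close> Int_lower2)
  then have "?N = insert v B" using N v by simp
  moreover have "v \<in> A" using v by auto
  ultimately show ?thesis by (intro bexI)
qed

lemma independent_position_diameter_2:
  assumes "independent_set (with_proj G) S"
    and "\<And>a c. \<lbrakk>a \<in> S; c \<in> S; a \<noteq> c\<rbrakk> \<Longrightarrow> \<exists>x. (a, x) \<in> parcs G \<and> (x, c) \<in> parcs G"
  shows "independent_position k (with_proj G) S"
proof -
  have "\<not> geodesic_through (parcs G) a b c l" if "a \<in> S" "b \<in> S" "c \<in> S" for a b c l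
    using assms that
    by (intro no_geodesic_through_diameter_2[of S]) (auto simp: independent_set_def)
  then show ?thesis using assms(1) by (simp add: independent_position_iff)
qed

text \<open>
  Connectedness in the form in which it is used: no proper nonempty set of vertices is closed under
  adjacency.
\<close>
lemma connected_closed_eq:
  assumes "connected (with_proj G)" and "A \<subseteq> pverts G" "A \<noteq> {}"
    and closed: "\<And>x y. \<lbrakk>x \<in> A; (x, y) \<in> parcs G\<rbrakk> \<Longrightarrow> y \<in> A"
  shows "A = pverts G"
proof -
  have arcs: "parcs (mk_symmetric (with_proj G)) = parcs G"
    using adj_mk_symmetric_eq pair_sym_arcs by simp
  obtain a where a: "a \<in> A" using assms by auto
  have "v \<in> A" if "v \<in> pverts G" for v
  proof -
    have "(a, v) \<in> rtrancl_on (pverts G) (parcs G)"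
      using assms(1,2) a that arcs
      unfolding connected_def strongly_connected_def reachable_def by auto
    then show ?thesis by (induction rule: rtrancl_on_induct) (use a closed in auto)
  qed
  then show ?thesis using assms(2) by auto
qed

lemma induced_P3_exists:
  assumes "connected (with_proj G)" and "\<not> complete_digraph (card (pverts G)) (with_proj G)"
  obtains a b c where "(a, b) \<in> parcs G" "(b, c) \<in> parcs G" "a \<noteq> c" "(a, c) \<notin> parcs G"
proof (rule ccontr)
  assume "\<not> thesis"
  then have trans: "(a, b) \<in> parcs G \<Longrightarrow> (b, c) \<in> parcs G \<Longrightarrow> a \<noteq> c \<Longrightarrow> (a, c) \<in> parcs G" for a b c
    using that by blast
  have nbrs: "insert u {v. (u, v) \<in> parcs G} = pverts G" if "u \<in> pverts G" for u
    by (rule connected_closed_eq[OF assms(1)]) (use that trans in \<open>auto dest: in_arcsD2\<close>)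
  then have "(u, v) \<in> parcs G" if "u \<in> pverts G" "v \<in> pverts G" "u \<noteq> v" for u v
  proof -
    have "v \<in> insert u {v. (u, v) \<in> parcs G}" using that(2) by (simp only: nbrs[OF that(1)])
    then show ?thesis using that(3) by simp
  qed
  then have "parcs G = {(u, v). (u, v) \<in> pverts G \<times> pverts G \<and> u \<noteq> v}"
    by (auto dest: in_arcsD1 in_arcsD2)
  then show False using assms(2) pair_finite_verts by (simp add: complete_digraph_pair_def)
qed

text \<open>
  The ends of an induced path with two edges form an independent position set.
\<close>
lemma two_le_ip:
  assumes "connected (with_proj G)" and "\<not> complete_digraph (card (pverts G)) (with_proj G)"
  shows "2 \<le> ip k (with_proj G)"
proof -
  obtain a b c where abc: "(a, b) \<in> parcs G" "(b, c) \<in> parcs G" "a \<noteq> c" "(a, c) \<notin> parcs G"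
    using induced_P3_exists[OF assms] .
  have "independent_position k (with_proj G) {a, c}"
    using abc by (intro independent_position_diameter_2)
      (auto simp: independent_set_def dest: in_arcsD1 in_arcsD2 arcs_symmetric)
  then show ?thesis using card_le_ip[of k "{a, c}"] abc(3) by simp
qed

lemma orig_walk:
  assumes "(a, b) \<in> parcs G ^^ i"
  shows "(Orig a, Orig b) \<in> parcs (Mycielskian G) ^^ i"
  using assms
proof (induction i arbitrary: b)
  case (Suc i)
  then obtain z where "(a, z) \<in> parcs G ^^ i" "(z, b) \<in> parcs G" by auto
  then show ?case using Suc.IH[of z] by auto
qed simp

text \<open>
  A walk of length at most 3 between originals cannot visit the root, since a walk through the root
  needs a twin before and after it and so has at least four edges. Replacing twins by originals then
  gives a walk of the same length in \<open>G\<close>.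
\<close>
lemma short_orig_walk_projects:
  assumes "(Orig a, Orig c) \<in> parcs (Mycielskian G) ^^ m" and "m < 4"
  shows "(a, c) \<in> parcs G ^^ m"
proof -
  consider "m = 0" | "m = 1" | "m = 2" | "m = 3" using assms(2) by arith
  then show ?thesis
  proof cases
    case 3
    then show ?thesis using assms(1)
      by (auto simp: numeral_2_eq_2 relcomp_unfold ex_myc_vertex dest: arcs_symmetric)
  next
    case 4
    then show ?thesis using assms(1)
      by (simp add: numeral_3_eq_3 relcomp_unfold ex_myc_vertex) (blast dest: arcs_symmetric)
  qed (use assms in auto)
qed

text \<open>
  The bound 4 is sharp: originals that are far apart in \<open>G\<close> have distance 4 in the Mycielskian. This
  is why independent 4-position sets occur.
\<close>
lemma geodesic_through_orig:
  assumes "geodesic_through (parcs G) a b c l" and "l \<le> 4"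
  shows "geodesic_through (parcs (Mycielskian G)) (Orig a) (Orig b) (Orig c) l"
proof -
  have "(Orig a, Orig c) \<notin> parcs (Mycielskian G) ^^ m" if "m < l" for m
    using assms short_orig_walk_projects[of a c m] that unfolding geodesic_through_def by fastforce
  then show ?thesis using assms(1) orig_walk unfolding geodesic_through_def by blast
qed

context
  fixes S :: "'a myc_vertex set"
  assumes gpS: "general_position (with_proj (Mycielskian G)) S"
begin

lemma gp_subset: "S \<subseteq> Orig ` pverts G \<union> Twin ` pverts G \<union> {Root}"
  using gpS by (simp add: general_position_Mycielskian_iff Mycielskian_pverts)

lemma gp_Orig: "Orig v \<in> S \<Longrightarrow> v \<in> pverts G" and gp_Twin: "Twin v \<in> S \<Longrightarrow> v \<in> pverts G"
  using gp_subset by auto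

lemma gp_no_P3:
  assumes "a \<in> S" "b \<in> S" "c \<in> S"
    and "(a, b) \<in> parcs (Mycielskian G)" "(b, c) \<in> parcs (Mycielskian G)" "a \<noteq> c"
  shows "(a, c) \<in> parcs (Mycielskian G)"
proof (rule ccontr)
  assume n: "(a, c) \<notin> parcs (Mycielskian G)"
  interpret M: pair_graph "Mycielskian G" by (rule pair_graph_Mycielskian)
  have "a \<noteq> b" "b \<noteq> c" using assms by auto
  then have "geodesic_through (parcs (Mycielskian G)) a b c 2"
    by (intro geodesic_through_P3I) (use assms n in blast)+
  then show False using gpS assms by (simp add: general_position_Mycielskian_iff)
qed

lemma gp_no_P4:
  assumes "a \<in> S" "b \<in> S" "c \<in> S"
    and "(a, b) \<in> parcs (Mycielskian G)" "(b, x) \<in> parcs (Mycielskian G)"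
      "(x, c) \<in> parcs (Mycielskian G)" "(a, c) \<notin> parcs (Mycielskian G)" "a \<noteq> c"
  shows "\<exists>y. (a, y) \<in> parcs (Mycielskian G) \<and> (y, c) \<in> parcs (Mycielskian G)"
proof (rule ccontr)
  assume n: "\<not> ?thesis"
  interpret M: pair_graph "Mycielskian G" by (rule pair_graph_Mycielskian)
  have "a \<noteq> b" using assms by auto
  then have "geodesic_through (parcs (Mycielskian G)) a b c 3"
    by (intro geodesic_through_P4I[of a b _ x c]) (use assms n in blast)+
  then show False using gpS assms by (simp add: general_position_Mycielskian_iff)
qed

text \<open>
  Otherwise \<open>u, w, u'\<close> is a geodesic inside \<open>S\<close>.
\<close>
lemma both_in_nbr_not_orig:
  assumes "u \<in> both_in S" "(u, w) \<in> parcs G"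
  shows "Orig w \<notin> S"
  using gp_no_P3[of "Orig u" "Orig w" "Twin u"] assms arcs_symmetric by (auto simp: both_in_def)

lemma independent_both_in: "independent_set (with_proj G) (both_in S)"
  using both_in_nbr_not_orig gp_Orig by (auto simp: independent_set_def both_in_def)

text \<open>
  Two twins have distance 2, so \<open>v', u, w'\<close> would be a geodesic.
\<close>
lemma orig_unique_twin_nbr:
  assumes "Orig u \<in> S" "Twin v \<in> S" "Twin w \<in> S" "(u, v) \<in> parcs G" "(u, w) \<in> parcs G"
  shows "v = w"
  using gp_no_P3[of "Twin v" "Orig u" "Twin w"] assms by auto

lemma twin_orig_nbrs_adjacent:
  assumes "Orig u \<in> S" "Orig v \<in> S" "Twin w \<in> S" "(u, w) \<in> parcs G" "(v, w) \<in> parcs G" "u \<noteq> v"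
  shows "(u, v) \<in> parcs G"
  using gp_no_P3[of "Orig u" "Twin w" "Orig v"] assms by auto

lemma independent_position_both_in: "independent_position 4 (with_proj G) (both_in S)"
proof -
  have "\<not> geodesic_through (parcs G) a b c l"
    if "a \<in> both_in S" "b \<in> both_in S" "c \<in> both_in S" "l \<le> 4" for a b c l
    using gpS that geodesic_through_orig[of a b c l]
    by (auto simp: general_position_Mycielskian_iff both_in_def)
  then show ?thesis using independent_both_in by (simp add: independent_position_iff)
qed

text \<open>
  Inclusion-exclusion for the originals and the twins in \<open>S\<close>, written additively to avoid truncated
  subtraction.
\<close>
lemma card_gp_set:
  assumes "Root \<notin> S"
  shows "card S + card (none_in G S) = card (pverts G) + card (both_in S)"
proof -
  define O' where "O' = {v. Orig v \<in> S}"
  define T where "T = {v. Twin v \<in> S}"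
  have sub: "O' \<subseteq> pverts G" "T \<subseteq> pverts G" unfolding O'_def T_def using gp_Orig gp_Twin by auto
  then have fin: "finite O'" "finite T" using pair_finite_verts by (auto intro: finite_subset)
  have "S = Orig ` O' \<union> Twin ` T"
    using gp_subset assms unfolding O'_def T_def by auto
  then have "card S = card O' + card T"
    using fin by (simp, subst card_Un_disjoint) (auto simp: card_image inj_on_def)
  also have "\<dots> = card (O' \<union> T) + card (O' \<inter> T)" using card_Un_Int fin by auto
  finally have 1: "card S = card (O' \<union> T) + card (O' \<inter> T)" .
  have "none_in G S = pverts G - (O' \<union> T)" "both_in S = O' \<inter> T"
    unfolding none_in_def both_in_def O'_def T_def by auto
  moreover have "card (O' \<union> T) \<le> card (pverts G)"
    using sub pair_finite_verts by (intro card_mono) auto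
  moreover have "card (pverts G - (O' \<union> T)) = card (pverts G) - card (O' \<union> T)"
    using sub fin by (intro card_Diff_subset) auto
  ultimately show ?thesis using 1 by simp
qed

lemma both_in_nbrs:
  assumes "u \<in> both_in S"
  shows "{v. (u, v) \<in> parcs G} \<subseteq> twin_only S \<union> none_in G S"
  using both_in_nbr_not_orig[OF assms] by (auto simp: twin_only_def none_in_def dest: in_arcsD2)

lemma card_nbrs_twin_only_le_1:
  assumes "u \<in> both_in S"
  shows "card ({v. (u, v) \<in> parcs G} \<inter> twin_only S) \<le> 1"
  using assms orig_unique_twin_nbr[of u]
  by (intro card_le_Suc0_iff_eq[THEN iffD2, folded One_nat_def])
    (auto simp: both_in_def twin_only_def)

lemma min_degree_le_card_none_in:
  assumes "both_in S \<noteq> {}"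
  shows "min_degree (with_proj G) \<le> card (none_in G S) + 1"
proof -
  obtain u where u: "u \<in> both_in S" using assms by auto
  let ?N = "{v. (u, v) \<in> parcs G}"
  have "u \<in> pverts G" using u gp_Orig by (auto simp: both_in_def)
  have "card ?N = card ((?N \<inter> twin_only S) \<union> (?N \<inter> none_in G S))"
    by (rule arg_cong[of _ _ card]) (use both_in_nbrs[OF u] in auto)
  also have "\<dots> \<le> card (?N \<inter> twin_only S) + card (?N \<inter> none_in G S)" by (rule card_Un_le)
  also have "card (?N \<inter> none_in G S) \<le> card (none_in G S)"
    using pair_finite_verts by (intro card_mono) (auto simp: none_in_def)
  finally show ?thesis
    using card_nbrs_twin_only_le_1[OF u] min_degree_le_nbrs[OF \<open>u \<in> pverts G\<close>] by linarith
qed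

lemma Root_unique_twin:
  assumes "Root \<in> S" "Twin u \<in> S" "Twin v \<in> S"
  shows "u = v"
  using gp_no_P3[of "Twin u" Root "Twin v"] assms gp_Twin by auto

lemma Root_twin_nbr:
  assumes "Root \<in> S" "Twin u \<in> S" "Orig w \<in> S"
  shows "(w, u) \<notin> parcs G"
  using gp_no_P3[of Root "Twin u" "Orig w"] assms gp_Twin by auto

text \<open>
  Geodesics with two edges in \<open>G\<close> remain geodesics, so not every original can be chosen.
\<close>
lemma orig_omitted:
  assumes "connected (with_proj G)" and "\<not> complete_digraph (card (pverts G)) (with_proj G)"
  obtains v where "v \<in> pverts G" "Orig v \<notin> S"
proof -
  obtain a b c where "(a, b) \<in> parcs G" "(b, c) \<in> parcs G" "a \<noteq> c" "(a, c) \<notin> parcs G"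
    using induced_P3_exists[OF assms] .
  then show thesis using that gp_no_P3[of "Orig a" "Orig b" "Orig c"]
    by (auto dest: in_arcsD1 in_arcsD2)
qed

text \<open>
  Two twins together with the root lie on a path with two edges, so at most one twin \<open>t'\<close> is chosen,
  and then no neighbour of \<open>t\<close> is. Without any twin, the omitted original compensates for the root and
  \<open>S\<close> has at most as many elements as \<open>G\<close>.
\<close>
lemma Root_card_le:
  assumes "connected (with_proj G)" and "\<not> complete_digraph (card (pverts G)) (with_proj G)"
    and "Root \<in> S" and "card (pverts G) < card S"
  obtains t where "Twin t \<in> S" "card S + card {v. (t, v) \<in> parcs G} \<le> card (pverts G) + 2"
    "S \<subseteq> insert Root (insert (Twin t) (Orig ` (pverts G - {v. (t, v) \<in> parcs G})))"
proof (cases "\<exists>t. Twin t \<in> S")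
  case True
  then obtain t where t: "Twin t \<in> S" by auto
  let ?N = "{v. (t, v) \<in> parcs G}"
  have sub: "S \<subseteq> insert Root (insert (Twin t) (Orig ` (pverts G - ?N)))"
  proof
    fix x assume "x \<in> S"
    then show "x \<in> insert Root (insert (Twin t) (Orig ` (pverts G - ?N)))"
      using gp_Orig Root_unique_twin[OF assms(3) t] Root_twin_nbr[OF assms(3) t]
      by (cases x) (auto intro!: imageI dest: arcs_symmetric)
  qed
  have "card S \<le> card (insert Root (insert (Twin t) (Orig ` (pverts G - ?N))))"
    using pair_finite_verts by (intro card_mono sub) auto
  also have "\<dots> \<le> Suc (Suc (card (Orig ` (pverts G - ?N))))"
    using pair_finite_verts by (simp add: card_insert_if)
  also have "card (Orig ` (pverts G - ?N)) = card (pverts G) - card ?N"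
    by (subst card_image) (auto simp: inj_on_def dest: in_arcsD2 intro!: card_Diff_subset)
  finally have "card S \<le> Suc (Suc (card (pverts G) - card ?N))" .
  moreover have "card ?N \<le> card (pverts G)"
    using pair_finite_verts by (intro card_mono) (auto dest: in_arcsD2)
  ultimately show thesis using that t sub by simp
next
  case False
  obtain v where v: "v \<in> pverts G" "Orig v \<notin> S" using orig_omitted[OF assms(1,2)] .
  have "S \<subseteq> insert Root (Orig ` (pverts G - {v}))" 
  proof
    fix x assume "x \<in> S"
    then show "x \<in> insert Root (Orig ` (pverts G - {v}))"
      using False gp_subset v by (cases x) auto
  qed
  then have "card S \<le> card (insert Root (Orig ` (pverts G - {v})))"
    using pair_finite_verts by (intro card_mono) auto
  also have "\<dots> = Suc (card (pverts G - {v}))"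
    using pair_finite_verts by (subst card_insert_disjoint) (auto simp: card_image inj_on_def)
  also have "\<dots> = card (pverts G)" using v pair_finite_verts card_Suc_Diff1 by metis
  finally show thesis using assms(4) by simp
qed

end
end

section \<open>Sets attaining the bound induce a partition\<close>

lemma (in pair_graph) is_matching_edges_between_iff:
  assumes "A \<inter> B = {}"
  shows "is_matching (edges_between (with_proj G) A B) \<longleftrightarrow>
    (\<forall>u\<in>A. \<forall>v\<in>B. \<forall>u'\<in>A. \<forall>v'\<in>B. (u, v) \<in> parcs G \<longrightarrow> (u', v') \<in> parcs G \<longrightarrow> (u = u' \<longleftrightarrow> v = v'))"
    (is "?L \<longleftrightarrow> ?R")
proof
  assume L: ?L
  show ?R
  proof (intro ballI impI)
    fix u v u' v'
    assume *: "u \<in> A" "v \<in> B" "u' \<in> A" "v' \<in> B" "(u, v) \<in> parcs G" "(u', v') \<in> parcs G"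
    then have e: "{u, v} \<in> edges_between (with_proj G) A B"
      and f: "{u', v'} \<in> edges_between (with_proj G) A B"
      by (auto simp: edges_between_def)
    have "{u, v} = {u', v'} \<or> {u, v} \<inter> {u', v'} = {}"
      using L[unfolded is_matching_def, rule_format, OF e f] by auto
    then show "u = u' \<longleftrightarrow> v = v'" using * assms by (auto simp: doubleton_eq_iff)
  qed
next
  assume R: ?R
  show ?L unfolding is_matching_def
  proof (intro ballI impI)
    fix e f
    assume "e \<in> edges_between (with_proj G) A B" "f \<in> edges_between (with_proj G) A B" and ef: "e \<noteq> f"
    then obtain u v u' v' where *: "e = {u, v}" "f = {u', v'}" "u \<in> A" "v \<in> B" "u' \<in> A" "v' \<in> B"
      "(u, v) \<in> parcs G" "(u', v') \<in> parcs G"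
      by (auto simp: edges_between_def)
    then have "u \<noteq> u'" "v \<noteq> v'" using R ef by blast+
    then show "e \<inter> f = {}" using * assms by auto
  qed
qed

text \<open>
  The cardinality assumptions are what equality in the upper bound gives, together with \<open>ip\<^sub>4 \<ge> 2\<close>.
\<close>
locale extremal_set = pair_graph +
  fixes S :: "'a myc_vertex set"
  assumes gpS: "general_position (with_proj (Mycielskian G)) S"
    and Root: "Root \<notin> S"
    and conn: "connected (with_proj G)"
    and card_both: "card (both_in S) = ip 4 (with_proj G)"
    and two_le: "2 \<le> card (both_in S)"
    and card_none: "card (none_in G S) + 1 = min_degree (with_proj G)"
begin

lemma finite_parts [simp]: "finite (both_in S)" "finite (twin_only S)" "finite (none_in G S)"
proof -
  have "both_in S \<subseteq> pverts G" "twin_only S \<subseteq> pverts G"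
    using gp_Twin[OF gpS] by (auto simp: both_in_def twin_only_def)
  then show "finite (both_in S)" "finite (twin_only S)" "finite (none_in G S)"
    using pair_finite_verts by (auto intro: finite_subset simp: none_in_def)
qed

lemma both_in_vert: "u \<in> both_in S \<Longrightarrow> u \<in> pverts G"
  using gp_Twin[OF gpS] by (auto simp: both_in_def)

lemma nbrs_both_in_ex:
  assumes "u \<in> both_in S"
  shows "\<exists>v\<in>twin_only S. {w. (u, w) \<in> parcs G} = insert v (none_in G S)"
  using assms
  by (intro nbrs_eq_insert both_in_vert both_in_nbrs[OF gpS] card_nbrs_twin_only_le_1[OF gpS]
      card_none) simp_all

definition mate :: "'a \<Rightarrow> 'a" where
  "mate u = (SOME v. v \<in> twin_only S \<and> {w. (u, w) \<in> parcs G} = insert v (none_in G S))"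

lemma
  assumes "u \<in> both_in S"
  shows mate_twin_only: "mate u \<in> twin_only S"
    and nbr_iff: "(u, w) \<in> parcs G \<longleftrightarrow> w = mate u \<or> w \<in> none_in G S"
proof -
  have "mate u \<in> twin_only S \<and> {w. (u, w) \<in> parcs G} = insert (mate u) (none_in G S)"
    unfolding mate_def by (rule someI_ex) (use nbrs_both_in_ex[OF assms] in blast)
  then show "mate u \<in> twin_only S" "(u, w) \<in> parcs G \<longleftrightarrow> w = mate u \<or> w \<in> none_in G S"
    by auto
qed

lemma both_in_not_adjacent: "u \<in> both_in S \<Longrightarrow> v \<in> both_in S \<Longrightarrow> (u, v) \<notin> parcs G"
  using independent_both_in[OF gpS] by (auto simp: independent_set_def)

text \<open>
  Two originals in \<open>S\<close> that share a chosen twin as a neighbour must be adjacent, but no neighbour of \<open>u\<close>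
  is in \<open>S\<close> as an original.
\<close>
lemma mate_owner_unique:
  assumes "u \<in> both_in S" "Orig v \<in> S" "(v, mate u) \<in> parcs G"
  shows "v = u"
proof (rule ccontr)
  assume "v \<noteq> u"
  then have "(u, v) \<in> parcs G"
    using twin_orig_nbrs_adjacent[OF gpS, of u v "mate u"] assms mate_twin_only[OF assms(1)]
      nbr_iff[OF assms(1)] by (auto simp: both_in_def twin_only_def)
  then show False using both_in_nbr_not_orig[OF gpS assms(1)] assms(2) by blast
qed

lemma inj_on_mate: "inj_on mate (both_in S)"
proof (rule inj_onI)
  fix u v
  assume "u \<in> both_in S" "v \<in> both_in S" "mate u = mate v"
  then show "u = v" using mate_owner_unique[of v u] nbr_iff[of u "mate v"] by (auto simp: both_in_def)
qed

text \<open>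
  Writing \<open>m\<close> for the mate of \<open>u\<close>, the path \<open>u, m', root, w'\<close> has three edges and contains three vertices
  of \<open>S\<close>. So it is not a geodesic, and \<open>u\<close> and \<open>w\<close> have distance 2.
\<close>
lemma common_nbr_of_twin:
  assumes "u \<in> both_in S" "Twin w \<in> S" "(u, w) \<notin> parcs G"
  obtains x where "(u, x) \<in> parcs G" "(x, w) \<in> parcs G"
proof -
  have m: "Twin (mate u) \<in> S" "mate u \<in> pverts G" "(u, mate u) \<in> parcs G" "w \<in> pverts G"
    using mate_twin_only[OF assms(1)] nbr_iff[OF assms(1)] gp_Twin[OF gpS] assms(2)
    by (auto simp: twin_only_def)
  have "\<exists>y. (Orig u, y) \<in> parcs (Mycielskian G) \<and> (y, Twin w) \<in> parcs (Mycielskian G)"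
    using gp_no_P4[OF gpS, of "Orig u" "Twin (mate u)" "Twin w" Root] m assms
    by (simp add: both_in_def)
  then show thesis using that by (auto simp: ex_myc_vertex)
qed

text \<open>
  If \<open>V4\<close> were empty, all vertices of \<open>V1\<close> would be pendant. The mates \<open>m\<close>, \<open>k\<close> of two of them, \<open>u\<close> and
  \<open>v\<close>, would be adjacent by \<open>common_nbr_of_twin\<close>, and \<open>u, m', k, v\<close> would be a geodesic with three
  vertices in \<open>S\<close>.
\<close>
lemma none_in_nonempty: "none_in G S \<noteq> {}"
proof
  assume empty: "none_in G S = {}"
  obtain u v where uv: "u \<in> both_in S" "v \<in> both_in S" "u \<noteq> v"
    using two_le card_le_Suc0_iff_eq[of "both_in S"] by auto
  let ?u' = "mate u" and ?v' = "mate v"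
  have N: "(u, w) \<in> parcs G \<longleftrightarrow> w = ?u'" "(v, w) \<in> parcs G \<longleftrightarrow> w = ?v'" for w
    using nbr_iff uv empty by auto
  have neq: "?u' \<noteq> ?v'" using inj_on_mate uv by (auto dest: inj_onD)
  have T: "Twin ?u' \<in> S" "Twin ?v' \<in> S"
    using mate_twin_only uv by (auto simp: twin_only_def)
  obtain x where "(u, x) \<in> parcs G" "(x, ?v') \<in> parcs G"
    using common_nbr_of_twin[OF uv(1) T(2)] N neq by auto
  then have adj: "(?u', ?v') \<in> parcs G" using N by simp
  have "\<exists>y. (Orig u, y) \<in> parcs (Mycielskian G) \<and> (y, Orig v) \<in> parcs (Mycielskian G)"
    using gp_no_P4[OF gpS, of "Orig u" "Twin ?u'" "Orig v" "Orig ?v'"] T uv N adj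
      both_in_not_adjacent[OF uv(1,2)] arcs_symmetric
    by (auto simp: both_in_def)
  then show False using N neq by (auto simp: ex_myc_vertex dest: arcs_symmetric)
qed

text \<open>
  Here the maximality of \<open>V1\<close> as an independent 4-position set is used. All of \<open>V1\<close> is adjacent to some
  vertex of \<open>V4\<close>, so adding \<open>x\<close> would give an independent set with pairwise distances 2, which is in
  independent position.
\<close>
lemma both_in_maximal:
  assumes "x \<in> pverts G" "x \<notin> both_in S"
    and common: "\<And>u. u \<in> both_in S \<Longrightarrow> \<exists>y. (u, y) \<in> parcs G \<and> (y, x) \<in> parcs G"
  obtains u where "u \<in> both_in S" "(u, x) \<in> parcs G"
proof (rule ccontr)
  assume "\<not> thesis"
  with that have nadj: "\<And>u. u \<in> both_in S \<Longrightarrow> (u, x) \<notin> parcs G" by metis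
  obtain z where z: "z \<in> none_in G S" using none_in_nonempty by auto
  have "independent_position 4 (with_proj G) (insert x (both_in S))"
  proof (rule independent_position_diameter_2)
    show "independent_set (with_proj G) (insert x (both_in S))"
      using assms(1) nadj both_in_not_adjacent both_in_vert
      unfolding independent_set_def by (auto dest: arcs_symmetric)
    have z_adj: "(u, z) \<in> parcs G" if "u \<in> both_in S" for u using nbr_iff that z by simp
    show "\<exists>y. (a, y) \<in> parcs G \<and> (y, c) \<in> parcs G"
      if "a \<in> insert x (both_in S)" "c \<in> insert x (both_in S)" "a \<noteq> c" for a c
      using that z_adj common arcs_symmetric by (metis insert_iff)
  qed
  then have "card (insert x (both_in S)) \<le> card (both_in S)"
    using card_le_ip card_both by simp
  then show False using assms(2) by simp
qed

text \<open>
  A twin that is nobody's mate would be at distance 2 from all of \<open>V1\<close>, contradicting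
  \<open>both_in_maximal\<close>.
\<close>
lemma twin_only_eq_mates: "twin_only S = mate ` both_in S"
proof
  show "twin_only S \<subseteq> mate ` both_in S"
  proof
    fix w assume w: "w \<in> twin_only S"
    then have T: "Twin w \<in> S" "w \<in> pverts G" "w \<notin> both_in S" "w \<notin> none_in G S"
      using gp_Twin[OF gpS] by (auto simp: twin_only_def both_in_def none_in_def)
    show "w \<in> mate ` both_in S"
    proof (cases "\<exists>u\<in>both_in S. (u, w) \<in> parcs G")
      case True
      then show ?thesis using nbr_iff T(4) by auto
    next
      case False
      then have "\<exists>y. (u, y) \<in> parcs G \<and> (y, w) \<in> parcs G" if "u \<in> both_in S" for u
        using common_nbr_of_twin[OF that T(1)] that by blast
      from both_in_maximal[OF T(2,3) this] show ?thesis using False by blast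
    qed
  qed
qed (use mate_twin_only in auto)

text \<open>
  It remains to exclude vertices \<open>x\<close> of which only the original is chosen. The set \<open>X\<close> of these
  vertices has no edges to \<open>V1\<close> or to mates. An edge from \<open>x\<close> to \<open>V4\<close> would put \<open>x\<close> at distance 2 from all
  of \<open>V1\<close>, which \<open>both_in_maximal\<close> forbids. So \<open>X\<close> is closed under adjacency, and connectedness makes
  it empty.
\<close>
lemma pverts_partition: "both_in S \<union> twin_only S \<union> none_in G S = pverts G"
proof -
  define X where "X = {x. Orig x \<in> S \<and> Twin x \<notin> S}"
  have XV: "X \<subseteq> pverts G" using gp_Orig[OF gpS] by (auto simp: X_def)
  have "X = {}"
  proof (rule ccontr)
    assume "X \<noteq> {}"
    have "y \<in> X" if xy: "x \<in> X" "(x, y) \<in> parcs G" for x y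
    proof (rule ccontr)
      assume "y \<notin> X"
      moreover have "y \<in> pverts G" using xy(2) by (auto dest: in_arcsD2)
      ultimately have "y \<in> both_in S \<or> y \<in> twin_only S \<or> y \<in> none_in G S"
        by (auto simp: X_def both_in_def twin_only_def none_in_def)
      then show False
      proof (elim disjE)
        assume "y \<in> both_in S"
        then show False using both_in_nbr_not_orig[OF gpS, of y x] xy arcs_symmetric by (auto simp: X_def)
      next
        assume "y \<in> twin_only S"
        then obtain u where "u \<in> both_in S" "y = mate u" using twin_only_eq_mates by auto
        then show False using mate_owner_unique[of u x] xy by (auto simp: X_def both_in_def)
      next
        assume y: "y \<in> none_in G S"
        have "(u, y) \<in> parcs G" if "u \<in> both_in S" for u using nbr_iff that y by simp
        then have "\<exists>z. (u, z) \<in> parcs G \<and> (z, x) \<in> parcs G" if "u \<in> both_in S" for u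
          using that xy(2) arcs_symmetric by blast
        moreover have "x \<in> pverts G" "x \<notin> both_in S" using xy XV by (auto simp: X_def both_in_def)
        ultimately obtain u where "u \<in> both_in S" "(u, x) \<in> parcs G"
          using both_in_maximal by metis
        then show False using both_in_nbr_not_orig[OF gpS, of u x] xy by (auto simp: X_def)
      qed
    qed
    then have "X = pverts G" using connected_closed_eq[OF conn XV \<open>X \<noteq> {}\<close>] by blast
    moreover obtain u where "u \<in> both_in S" using two_le by (cases "both_in S = {}") auto
    ultimately show False using both_in_vert by (auto simp: X_def both_in_def)
  qed
  then show ?thesis
    using gp_Orig[OF gpS] gp_Twin[OF gpS]
    by (auto simp: X_def both_in_def twin_only_def none_in_def)
qed

text \<open>
  If \<open>w\<close> is not adjacent to the mate of \<open>u\<close>, then the common neighbour of \<open>u\<close> and \<open>w\<close> can only be a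
  vertex of \<open>V4\<close>, as all other neighbours of \<open>u\<close> are ruled out.
\<close>
lemma twin_only_nonuniversal:
  assumes "w \<in> twin_only S" "\<not> universal_vertex (with_proj G \<restriction> twin_only S) w"
  shows "\<exists>z\<in>none_in G S. (w, z) \<in> parcs G"
proof -
  have "\<exists>v\<in>twin_only S. v \<noteq> w \<and> (w, v) \<notin> parcs G"
    using assms by (auto simp: universal_vertex_def arcs_ends_conv image_iff)
  then obtain u where u: "u \<in> both_in S" "mate u \<noteq> w" "(w, mate u) \<notin> parcs G"
    using twin_only_eq_mates by auto
  have w: "Twin w \<in> S" "w \<notin> none_in G S" using assms(1) by (auto simp: twin_only_def none_in_def)
  then have "(u, w) \<notin> parcs G" using nbr_iff[OF u(1)] u(2) by auto
  then obtain x where "(u, x) \<in> parcs G" "(x, w) \<in> parcs G"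
    using common_nbr_of_twin[OF u(1) w(1)] by blast
  then show ?thesis using nbr_iff[OF u(1), of x] u(3) arcs_symmetric by blast
qed

lemma mate_matching: "is_matching (edges_between (with_proj G) (both_in S) (twin_only S))"
proof -
  have disj: "both_in S \<inter> twin_only S = {}" by (auto simp: both_in_def twin_only_def)
  have mate_eq: "v = mate u" if "u \<in> both_in S" "v \<in> twin_only S" "(u, v) \<in> parcs G" for u v
    using nbr_iff[OF that(1), of v] that(2,3) by (auto simp: twin_only_def none_in_def)
  show ?thesis
    unfolding is_matching_edges_between_iff[OF disj]
    using mate_eq inj_on_mate by (metis inj_onD)
qed

lemma card_twin_only: "card (twin_only S) = card (both_in S)"
  using card_image[OF inj_on_mate] twin_only_eq_mates by simp

end

section \<open>A partition yields a set attaining the bound\<close>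

text \<open>
  The partition of the characterisation, with truncated subtraction avoided in the size of \<open>V4\<close>.
\<close>
locale matched_partition = pair_graph +
  fixes V1 V2 V4 :: "'a set"
  assumes parts: "V1 \<union> V2 \<union> V4 = pverts G"
    and disj: "V1 \<inter> V2 = {}" "V1 \<inter> V4 = {}" "V2 \<inter> V4 = {}"
    and card_V1: "card V1 = card V2"
    and card_V4_less: "card V4 < card V2"
    and card_V4: "card V4 + 1 = min_degree (with_proj G)"
    and indep: "independent_set (with_proj G) V1"
    and matching: "is_matching (edges_between (with_proj G) V1 V2)"
    and cover: "\<And>v. \<lbrakk>v \<in> V2; \<not> universal_vertex (with_proj G \<restriction> V2) v\<rbrakk> \<Longrightarrow> \<exists>w\<in>V4. (v, w) \<in> parcs G"
begin

lemma finite_classes [simp]: "finite V1" "finite V2" "finite V4"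
  using pair_finite_verts unfolding parts[symmetric] by auto

lemma V1_vert: "v \<in> V1 \<Longrightarrow> v \<in> pverts G" and V2_vert: "v \<in> V2 \<Longrightarrow> v \<in> pverts G"
  using parts by auto

lemma card_pverts: "card (pverts G) = 2 * card V1 + card V4"
proof -
  have "card (pverts G) = card (V1 \<union> V2) + card V4"
    unfolding parts[symmetric] using disj by (intro card_Un_disjoint) auto
  also have "card (V1 \<union> V2) = card V1 + card V2"
    using disj by (intro card_Un_disjoint) auto
  finally show ?thesis using card_V1 by simp
qed

lemma V1_not_adjacent: "u \<in> V1 \<Longrightarrow> v \<in> V1 \<Longrightarrow> (u, v) \<notin> parcs G"
  using indep by (auto simp: independent_set_def)

lemma matching_unique:
  assumes "u \<in> V1" "v \<in> V2" "u' \<in> V1" "v' \<in> V2" "(u, v) \<in> parcs G" "(u', v') \<in> parcs G"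
  shows "u = u' \<longleftrightarrow> v = v'"
  using matching assms unfolding is_matching_edges_between_iff[OF disj(1)] by metis

lemma nbrs_V1_ex:
  assumes "u \<in> V1"
  shows "\<exists>v\<in>V2. {w. (u, w) \<in> parcs G} = insert v V4"
proof (rule nbrs_eq_insert[OF V1_vert[OF assms] _ _ finite_classes(3) card_V4])
  show "{w. (u, w) \<in> parcs G} \<subseteq> V2 \<union> V4"
    using V1_not_adjacent[OF assms] parts by (auto dest: in_arcsD2)
  show "card ({w. (u, w) \<in> parcs G} \<inter> V2) \<le> 1"
    unfolding One_nat_def
    by (subst card_le_Suc0_iff_eq) (use matching_unique assms in auto)
qed

definition partner :: "'a \<Rightarrow> 'a" where
  "partner u = (SOME v. v \<in> V2 \<and> {w. (u, w) \<in> parcs G} = insert v V4)"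

lemma
  assumes "u \<in> V1"
  shows partner_V2: "partner u \<in> V2"
    and nbr_V1_iff: "(u, w) \<in> parcs G \<longleftrightarrow> w = partner u \<or> w \<in> V4"
proof -
  have "partner u \<in> V2 \<and> {w. (u, w) \<in> parcs G} = insert (partner u) V4"
    unfolding partner_def by (rule someI_ex) (use nbrs_V1_ex[OF assms] in blast)
  then show "partner u \<in> V2" "(u, w) \<in> parcs G \<longleftrightarrow> w = partner u \<or> w \<in> V4"
    by auto
qed

lemma inj_on_partner: "inj_on partner V1"
proof (rule inj_onI)
  fix u v assume *: "u \<in> V1" "v \<in> V1" "partner u = partner v"
  then show "u = v"
    using matching_unique[of u "partner u" v "partner v"] partner_V2 nbr_V1_iff by auto
qed

lemma partner_surj: "partner ` V1 = V2"
  using partner_V2 card_image[OF inj_on_partner] card_V1 by (intro card_subset_eq) auto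

lemma partner_not_V1: "u \<in> V1 \<Longrightarrow> partner u \<notin> V1"
  using partner_V2 disj by auto

lemma nbr_V1_V2_iff: "u \<in> V1 \<Longrightarrow> v \<in> V2 \<Longrightarrow> (u, v) \<in> parcs G \<longleftrightarrow> v = partner u"
  using nbr_V1_iff disj by auto

text \<open>
  An independent set avoiding \<open>V4\<close> has at most one vertex in each matched pair. If it meets \<open>V4\<close>, it
  avoids \<open>V1\<close>. Then a vertex \<open>a\<close> of it in \<open>V2\<close> has at most one neighbour in \<open>V1\<close> and otherwise only
  neighbours in \<open>V2 \<union> V4\<close> outside the set, so its degree, which is at least \<open>|V4| + 1\<close>, limits the size of
  the set.
\<close>
lemma card_independent_le:
  assumes "independent_set (with_proj G) A"
  shows "card A \<le> card V1"
proof -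
  have AV: "A \<subseteq> pverts G" and nadj: "\<And>u v. u \<in> A \<Longrightarrow> v \<in> A \<Longrightarrow> (u, v) \<notin> parcs G"
    using assms by (auto simp: independent_set_def)
  show ?thesis
  proof (cases "A \<inter> V4 = {}")
    case True
    then have A: "A = (A \<inter> V1) \<union> (A \<inter> V2)" using AV parts by auto
    have "card A = card (A \<inter> V1) + card (A \<inter> V2)"
      by (subst A, rule card_Un_disjoint) (use disj in auto)
    also have "card (A \<inter> V1) = card (partner ` (A \<inter> V1))"
      by (intro card_image[symmetric] inj_on_subset[OF inj_on_partner] Int_lower2)
    also have "\<dots> + card (A \<inter> V2) = card (partner ` (A \<inter> V1) \<union> (A \<inter> V2))"
    proof (rule card_Un_disjoint[symmetric])
      show "partner ` (A \<inter> V1) \<inter> (A \<inter> V2) = {}" using nadj nbr_V1_iff by auto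
    qed auto
    also have "\<dots> \<le> card V2" using partner_V2 by (intro card_mono) auto
    finally show ?thesis using card_V1 by simp
  next
    case False
    then obtain z where z: "z \<in> A" "z \<in> V4" by auto
    then have "A \<inter> V1 = {}" using nadj nbr_V1_iff by auto
    then have A: "A = (A \<inter> V2) \<union> (A \<inter> V4)" using AV parts by auto
    have cardA: "card A = card (A \<inter> V2) + card (A \<inter> V4)"
      by (subst A, rule card_Un_disjoint) (use disj in auto)
    show ?thesis
    proof (cases "A \<inter> V2 = {}")
      case True
      then have "card A \<le> card V4" using cardA by (auto intro: card_mono)
      then show ?thesis using card_V4_less card_V1 by simp
    next
      case False
      then obtain a where a: "a \<in> A" "a \<in> V2" by auto
      let ?N = "{w. (a, w) \<in> parcs G}"
      have "card (?N \<inter> V1) \<le> 1"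
        unfolding One_nat_def
        by (subst card_le_Suc0_iff_eq) (use matching_unique a arcs_symmetric in auto)
      moreover have "?N \<subseteq> (?N \<inter> V1) \<union> ((V2 - A \<inter> V2) \<union> (V4 - A \<inter> V4))"
        using nadj a(1) parts by (auto dest: in_arcsD2)
      then have "card ?N \<le> card ((?N \<inter> V1) \<union> ((V2 - A \<inter> V2) \<union> (V4 - A \<inter> V4)))"
        by (intro card_mono) auto
      then have "card ?N \<le> card (?N \<inter> V1) + (card (V2 - A \<inter> V2) + card (V4 - A \<inter> V4))"
        using card_Un_le[of "?N \<inter> V1" "(V2 - A \<inter> V2) \<union> (V4 - A \<inter> V4)"]
          card_Un_le[of "V2 - A \<inter> V2" "V4 - A \<inter> V4"] by linarith
      moreover have "card (V2 - A \<inter> V2) = card V2 - card (A \<inter> V2)" 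
        "card (V4 - A \<inter> V4) = card V4 - card (A \<inter> V4)"
        by (auto intro!: card_Diff_subset)
      moreover have "card (A \<inter> V2) \<le> card V2" "card (A \<inter> V4) \<le> card V4"
        by (auto intro!: card_mono)
      moreover have "min_degree (with_proj G) \<le> card ?N"
        using min_degree_le_nbrs V2_vert[OF a(2)] .
      ultimately show ?thesis using cardA card_V4 card_V1 by linarith
    qed
  qed
qed

lemma independent_position_V1:
  assumes "V4 \<noteq> {}"
  shows "independent_position k (with_proj G) V1"
proof -
  obtain z where "z \<in> V4" using assms by auto
  then have "\<And>u. u \<in> V1 \<Longrightarrow> (u, z) \<in> parcs G" using nbr_V1_iff by simp
  then show ?thesis
    by (intro independent_position_diameter_2 indep) (auto intro!: exI[of _ z] dest: arcs_symmetric)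
qed

lemma ip_eq_card_V1:
  assumes "V4 \<noteq> {}"
  shows "ip k (with_proj G) = card V1"
proof (rule antisym)
  show "ip k (with_proj G) \<le> card V1"
    by (rule ip_le) (auto simp: independent_position_def intro: card_independent_le)
  show "card V1 \<le> ip k (with_proj G)"
    using card_le_ip independent_position_V1[OF assms] .
qed

text \<open>
  Distances in this set are at most 2 as soon as \<open>V4\<close> is nonempty, because any vertex of \<open>V4\<close> is a
  common neighbour of all of \<open>V1\<close>, and twins have the root as a common neighbour.
\<close>
definition gp_witness :: "'a myc_vertex set" where
  "gp_witness = Orig ` V1 \<union> Twin ` V1 \<union> Twin ` V2"

lemma card_gp_witness: "card gp_witness = 3 * card V1"
proof -
  have "gp_witness = Orig ` V1 \<union> Twin ` (V1 \<union> V2)" by (auto simp: gp_witness_def)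
  then have "card gp_witness = card (Orig ` V1) + card (Twin ` (V1 \<union> V2))"
    by (simp, subst card_Un_disjoint) auto
  also have "\<dots> = card V1 + card (V1 \<union> V2)" by (simp add: card_image inj_on_def)
  also have "card (V1 \<union> V2) = card V1 + card V2" using disj by (simp add: card_Un_disjoint)
  finally show ?thesis using card_V1 by simp
qed

text \<open>
  This is where property (v) enters: the common neighbour is the partner of \<open>u\<close> if \<open>v\<close> is universal in
  \<open>V2\<close>, and a neighbour of \<open>v\<close> in \<open>V4\<close> otherwise.
\<close>
lemma V1_V2_distance_2:
  assumes "V4 \<noteq> {}" "u \<in> V1" "v \<in> V2" "v \<noteq> partner u"
  shows "\<exists>x. (u, x) \<in> parcs G \<and> (x, v) \<in> parcs G"
proof (cases "universal_vertex (with_proj G \<restriction> V2) v")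
  case True
  then have "(v, partner u) \<in> parcs G"
    using partner_V2[OF assms(2)] assms(4) by (auto simp: universal_vertex_def arcs_ends_conv)
  then show ?thesis using nbr_V1_iff[OF assms(2)] arcs_symmetric by auto
next
  case False
  then obtain w where "w \<in> V4" "(v, w) \<in> parcs G" using cover assms(3) by auto
  then show ?thesis using nbr_V1_iff[OF assms(2)] arcs_symmetric by auto
qed

lemma general_position_gp_witness:
  assumes "V4 \<noteq> {}"
  shows "general_position (with_proj (Mycielskian G)) gp_witness"
proof -
  let ?R = "parcs (Mycielskian G)"
  interpret M: pair_graph "Mycielskian G" by (rule pair_graph_Mycielskian)
  obtain z where z: "z \<in> V4" using assms by auto
  have uz: "(u, z) \<in> parcs G" "(z, u) \<in> parcs G" if "u \<in> V1" for u
    using nbr_V1_iff[OF that] z arcs_symmetric by auto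
  have OO: "\<exists>x. (Orig u, x) \<in> ?R \<and> (x, Orig v) \<in> ?R" if "u \<in> V1" "v \<in> V1" for u v
    using uz that by (intro exI[of _ "Orig z"]) simp
  have OT: "\<exists>x. (Orig u, x) \<in> ?R \<and> (x, Twin v) \<in> ?R" if "u \<in> V1" "v \<in> V1" for u v
    using uz that by (intro exI[of _ "Orig z"]) simp
  have OT': "\<exists>x. (Orig u, x) \<in> ?R \<and> (x, Twin v) \<in> ?R" if "u \<in> V1" "v \<in> V2" "(u, v) \<notin> parcs G" for u v
    using V1_V2_distance_2[OF assms that(1,2)] nbr_V1_iff[OF that(1), of v] that(3)
    by (auto simp: ex_myc_vertex)
  have TT: "\<exists>x. (Twin u, x) \<in> ?R \<and> (x, Twin v) \<in> ?R" if "u \<in> pverts G" "v \<in> pverts G" for u v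
    using that by (intro exI[of _ Root]) simp
  have swap: "\<exists>x. (b, x) \<in> ?R \<and> (x, a) \<in> ?R" if "\<exists>x. (a, x) \<in> ?R \<and> (x, b) \<in> ?R" for a b
    using that M.arcs_symmetric by auto
  \<comment> \<open>The edges inside the set form a matching, so they contain no path with two edges.\<close>
  have edge: "\<exists>u\<in>V1. a = Orig u \<and> b = Twin (partner u) \<or> b = Orig u \<and> a = Twin (partner u)"
    if "a \<in> gp_witness" "b \<in> gp_witness" "(a, b) \<in> ?R" for a b
    using that V1_not_adjacent nbr_V1_V2_iff unfolding gp_witness_def
    by (elim UnE imageE) simp_all
  have "\<not> geodesic_through ?R a b c l" if "a \<in> gp_witness" "b \<in> gp_witness" "c \<in> gp_witness" for a b c l
  proof (rule no_geodesic_through_diameter_2[OF _ _ that])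
    show "\<exists>x. (a, x) \<in> ?R \<and> (x, c) \<in> ?R"
      if "a \<in> gp_witness" "c \<in> gp_witness" "a \<noteq> c" "(a, c) \<notin> ?R" for a c
      using that OO OT OT' TT swap[OF OT] swap[OF OT'] V1_vert V2_vert
      unfolding gp_witness_def by (elim UnE imageE) auto
    show "a = c"
      if "a \<in> gp_witness" "b \<in> gp_witness" "c \<in> gp_witness" "(a, b) \<in> ?R" "(b, c) \<in> ?R" for a b c
      using edge[OF that(1,2,4)] edge[OF that(2,3,5)] inj_on_partner by (auto dest: inj_onD)
  qed
  moreover have "gp_witness \<subseteq> pverts (Mycielskian G)"
    using V1_vert V2_vert by (auto simp: gp_witness_def Mycielskian_pverts)
  ultimately show ?thesis by (simp add: general_position_Mycielskian_iff)
qed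

end

section \<open>Cliques with pendant vertices are not abundant\<close>

context matched_partition
begin

text \<open>
  The four vertices of the Mycielskian above a matched pair. If \<open>V4\<close> is empty, there are \<open>n / 2\<close> blocks, so a set
  with more than \<open>n\<close> elements that avoids the root must meet one of them in at least three vertices.
\<close>
definition block :: "'a \<Rightarrow> 'a myc_vertex set" where
  "block u = {Orig u, Twin (partner u), Twin u, Orig (partner u)}"

context
  fixes S :: "'a myc_vertex set"
  assumes V4_empty: "V4 = {}"
    and gpS: "general_position (with_proj (Mycielskian G)) S"
begin

lemma pendant_nbr_iff: "u \<in> V1 \<Longrightarrow> (u, x) \<in> parcs G \<longleftrightarrow> x = partner u"
  "u \<in> V1 \<Longrightarrow> (x, u) \<in> parcs G \<longleftrightarrow> x = partner u"
  using nbr_V1_iff V4_empty arcs_symmetric by auto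

lemma partners_adjacent:
  assumes "u \<in> V1" "w \<in> V1" "u \<noteq> w"
  shows "(partner u, partner w) \<in> parcs G" "partner u \<noteq> partner w"
proof -
  show "partner u \<noteq> partner w" using assms inj_on_partner by (auto dest: inj_onD)
  moreover have "universal_vertex (with_proj G \<restriction> V2) (partner u)"
    using cover[of "partner u"] partner_V2 assms V4_empty by auto
  ultimately show "(partner u, partner w) \<in> parcs G"
    using partner_V2[OF assms(2)] by (auto simp: universal_vertex_def arcs_ends_conv)
qed

text \<open>
  Write \<open>p\<close> and \<open>q\<close> for the partners of \<open>u\<close> and \<open>w\<close>. If \<open>u\<close> and \<open>p'\<close> are chosen, the geodesics
  \<open>u, p', q\<close> and \<open>u, p', q, w\<close> and \<open>u, p', q, w'\<close> leave only \<open>q'\<close> for the block of \<open>w\<close>. If \<open>u'\<close> and \<open>p\<close> are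
  chosen, the geodesics \<open>u', p, q\<close> and \<open>u', p, q'\<close> and \<open>u', p, q, w\<close> leave only \<open>w'\<close>.
\<close>
lemma block_other_le_1:
  assumes "u \<in> V1" "w \<in> V1" "w \<noteq> u"
    and "Orig u \<in> S \<and> Twin (partner u) \<in> S \<or> Twin u \<in> S \<and> Orig (partner u) \<in> S"
  shows "card (S \<inter> block w) \<le> 1"
proof -
  let ?u' = "partner u" and ?w' = "partner w"
  note N = pendant_nbr_iff[OF assms(1)] pendant_nbr_iff[OF assms(2)]
  have adj: "(?u', ?w') \<in> parcs G" "(?w', ?u') \<in> parcs G" "?u' \<noteq> ?w'"
    using partners_adjacent assms by auto
  have neq: "u \<noteq> ?w'" "w \<noteq> ?u'" "u \<noteq> ?u'" "w \<noteq> ?w'" using partner_not_V1 assms(1,2) by metis+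
  from assms(4) have "S \<inter> block w \<subseteq> {Twin ?w'} \<or> S \<inter> block w \<subseteq> {Twin w}"
  proof (elim disjE conjE)
    assume S: "Orig u \<in> S" "Twin ?u' \<in> S"
    have "Orig ?w' \<notin> S"
      using gp_no_P3[OF gpS S, of "Orig ?w'"] N adj neq by auto
    moreover have "Orig w \<notin> S"
      using gp_no_P4[OF gpS S, of "Orig w" "Orig ?w'"] N adj neq assms(3) by (auto simp: ex_myc_vertex)
    moreover have "Twin w \<notin> S"
      using gp_no_P4[OF gpS S, of "Twin w" "Orig ?w'"] N adj neq assms(3) by (auto simp: ex_myc_vertex)
    ultimately show ?thesis by (auto simp: block_def)
  next
    assume S: "Twin u \<in> S" "Orig ?u' \<in> S"
    have "Orig ?w' \<notin> S"
      using gp_no_P3[OF gpS S, of "Orig ?w'"] N adj neq by auto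
    moreover have "Twin ?w' \<notin> S"
      using gp_no_P3[OF gpS S, of "Twin ?w'"] N adj neq by auto
    moreover have "Orig w \<notin> S"
      using gp_no_P4[OF gpS S, of "Orig w" "Orig ?w'"] N adj neq assms(3) by (auto simp: ex_myc_vertex)
    ultimately show ?thesis by (auto simp: block_def)
  qed
  then obtain x where "S \<inter> block w \<subseteq> {x}" by auto
  then have "card (S \<inter> block w) \<le> card {x}" by (intro card_mono) auto
  then show ?thesis by simp
qed

lemma block_le_3:
  assumes "u \<in> V1"
  shows "card (S \<inter> block u) \<le> 3"
proof -
  have "\<not> block u \<subseteq> S"
    using gp_no_P3[OF gpS, of "Orig u" "Orig (partner u)" "Twin u"] pendant_nbr_iff[OF assms]
    by (auto simp: block_def)
  then have "S \<inter> block u \<subset> block u" by auto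
  then have "card (S \<inter> block u) < card (block u)"
    by (rule psubset_card_mono[rotated]) (simp add: block_def)
  also have "card (block u) \<le> 4" unfolding block_def by (simp add: card_insert_if)
  finally show ?thesis by simp
qed

lemma block_le_2:
  assumes "\<not> (Orig u \<in> S \<and> Twin (partner u) \<in> S \<or> Twin u \<in> S \<and> Orig (partner u) \<in> S)"
  shows "card (S \<inter> block u) \<le> 2"
proof -
  have "S \<inter> block u \<subseteq> {if Orig u \<in> S then Orig u else Twin (partner u),
      if Twin u \<in> S then Twin u else Orig (partner u)}" (is "_ \<subseteq> {?x, ?y}")
    using assms by (auto simp: block_def)
  then have "card (S \<inter> block u) \<le> card {?x, ?y}" by (intro card_mono) auto
  also have "\<dots> \<le> 2" by (simp add: card_insert_if)
  finally show ?thesis .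
qed

text \<open>
  Either every block contributes at most two vertices, or one block contributes at most three and every
  other one at most one. With at least two blocks, both cases stay within two vertices per block on
  average.
\<close>
lemma corona_card_le_no_Root:
  assumes "2 \<le> card V1" "Root \<notin> S"
  shows "card S \<le> card (pverts G)"
proof -
  have "S \<subseteq> (\<Union>u\<in>V1. S \<inter> block u)"
  proof
    fix x assume x: "x \<in> S"
    have *: "\<exists>u\<in>V1. v = u \<or> v = partner u" if "v \<in> pverts G" for v
      using that parts partner_surj V4_empty by auto
    show "x \<in> (\<Union>u\<in>V1. S \<inter> block u)"
      using x assms(2) gp_Orig[OF gpS] gp_Twin[OF gpS] *
      by (cases x) (fastforce simp: block_def)+
  qed
  then have "card S \<le> card (\<Union>u\<in>V1. S \<inter> block u)"
    by (intro card_mono) (auto simp: block_def)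
  also have "\<dots> \<le> (\<Sum>u\<in>V1. card (S \<inter> block u))" by (rule card_UN_le) simp
  also have "\<dots> \<le> 2 * card V1"
  proof (cases "\<exists>u\<in>V1. Orig u \<in> S \<and> Twin (partner u) \<in> S \<or> Twin u \<in> S \<and> Orig (partner u) \<in> S")
    case True
    then obtain u where u: "u \<in> V1"
      "Orig u \<in> S \<and> Twin (partner u) \<in> S \<or> Twin u \<in> S \<and> Orig (partner u) \<in> S" by auto
    have "(\<Sum>w\<in>V1. card (S \<inter> block w)) = card (S \<inter> block u) + (\<Sum>w\<in>V1 - {u}. card (S \<inter> block w))"
      using u(1) by (simp add: sum.remove)
    also have "(\<Sum>w\<in>V1 - {u}. card (S \<inter> block w)) \<le> card (V1 - {u}) * 1"
      using sum_bounded_above[of "V1 - {u}" "\<lambda>w. card (S \<inter> block w)" 1]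
        block_other_le_1[OF u(1) _ _ u(2)] by simp
    also have "card (V1 - {u}) * 1 = card V1 - 1" using u(1) by simp
    finally show ?thesis using block_le_3[OF u(1)] assms(1) by linarith
  next
    case False
    then have "(\<Sum>u\<in>V1. card (S \<inter> block u)) \<le> (\<Sum>u\<in>V1. 2)"
      using block_le_2 by (intro sum_mono) auto
    then show ?thesis by simp
  qed
  finally show ?thesis using card_pverts by simp
qed

text \<open>
  With the root, more than \<open>n\<close> elements are possible only if the unique chosen twin \<open>t'\<close> belongs to a
  pendant vertex \<open>t\<close> and all originals except the partner of \<open>t\<close> are chosen. But then, for any other
  pendant vertex \<open>w\<close>, the geodesic from \<open>w\<close> to \<open>t'\<close> through the two partners has three chosen vertices.
\<close>
lemma corona_card_le:
  assumes "connected (with_proj G)" and "\<not> complete_digraph (card (pverts G)) (with_proj G)"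
    and "2 \<le> card V1"
  shows "card S \<le> card (pverts G)"
proof (cases "Root \<in> S")
  case False
  then show ?thesis using corona_card_le_no_Root assms(3) by simp
next
  case Root: True
  show ?thesis
  proof (rule ccontr)
    assume "\<not> ?thesis"
    then have gt: "card (pverts G) < card S" by simp
    obtain t where t: "Twin t \<in> S" and card: "card S + card {v. (t, v) \<in> parcs G} \<le> card (pverts G) + 2"
      and sub: "S \<subseteq> insert Root (insert (Twin t) (Orig ` (pverts G - {v. (t, v) \<in> parcs G})))"
        (is "_ \<subseteq> ?U")
      using Root_card_le[OF gpS assms(1,2) Root gt] .
    have other: "\<exists>w\<in>V1. w \<noteq> u" for u
    proof (rule ccontr)
      assume "\<not> ?thesis"
      then have "V1 \<subseteq> {u}" by auto
      then have "card V1 \<le> card {u}" by (intro card_mono) auto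
      then show False using assms(3) by simp
    qed
    have "t \<in> V1"
    proof (rule ccontr)
      assume "t \<notin> V1"
      then obtain u where u: "u \<in> V1" "t = partner u"
        using gp_Twin[OF gpS t] parts partner_surj V4_empty by auto
      obtain w where w: "w \<in> V1" "w \<noteq> u" using other by auto
      have "{u, partner w} \<subseteq> {v. (t, v) \<in> parcs G}"
        using u w pendant_nbr_iff partners_adjacent[of u w] by auto
      then have "card {u, partner w} \<le> card {v. (t, v) \<in> parcs G}" by (intro card_mono) auto
      moreover have "u \<noteq> partner w" using u partner_not_V1[OF w(1)] by auto
      ultimately show False using card gt by simp
    qed
    then obtain w where w: "w \<in> V1" "w \<noteq> t" using other by auto
    have N: "{v. (t, v) \<in> parcs G} = {partner t}" using pendant_nbr_iff(1)[OF \<open>t \<in> V1\<close>] by auto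
    have V: "partner t \<in> pverts G" "w \<in> pverts G" "partner w \<in> pverts G"
      using V2_vert V1_vert partner_V2 \<open>t \<in> V1\<close> w by auto
    have "card ?U = Suc (Suc (card (Orig ` (pverts G - {partner t}))))"
      unfolding N using pair_finite_verts by (simp add: card_insert_if image_iff)
    also have "card (Orig ` (pverts G - {partner t})) = card (pverts G - {partner t})"
      by (rule card_image) (simp add: inj_on_def)
    also have "Suc (Suc (card (pverts G - {partner t}))) = Suc (card (pverts G))" using V(1) pair_finite_verts card_Suc_Diff1 by metis
    finally have "S = ?U" using gt by (intro card_seteq[OF _ sub]) (auto simp: pair_finite_verts)
    moreover have "partner w \<noteq> partner t" "(partner w, partner t) \<in> parcs G"
      using partners_adjacent[OF w(1) \<open>t \<in> V1\<close> w(2)] by auto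
    moreover have "w \<noteq> partner t" using partner_not_V1[OF \<open>t \<in> V1\<close>] w(1) by auto
    ultimately have S: "Orig w \<in> S" "Orig (partner w) \<in> S" and adj: "(partner w, partner t) \<in> parcs G"
      using V N by auto
    have "\<exists>y. (Orig w, y) \<in> parcs (Mycielskian G) \<and> (y, Twin t) \<in> parcs (Mycielskian G)"
      using gp_no_P4[OF gpS S t, of "Orig (partner t)"] adj w V1_not_adjacent \<open>t \<in> V1\<close>
        pendant_nbr_iff by auto
    then show False
      using pendant_nbr_iff[OF w(1)] pendant_nbr_iff[OF \<open>t \<in> V1\<close>] \<open>partner w \<noteq> partner t\<close>
      by (auto simp: ex_myc_vertex)
  qed
qed

end
end

section \<open>The characterisation of equality\<close>

text \<open>
  The case of equality never occurs for a set that contains the root, because \<open>ip\<^sub>4 \<ge> 2\<close>.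
\<close>
lemma (in pair_graph) gp_set_card_bound:
  assumes "connected (with_proj G)" and "\<not> complete_digraph (card (pverts G)) (with_proj G)"
    and gpS: "general_position (with_proj (Mycielskian G)) S"
    and "card (pverts G) < card S"
  shows "card S + min_degree (with_proj G) \<le> card (pverts G) + ip 4 (with_proj G) + 1"
    and "card S + min_degree (with_proj G) = card (pverts G) + ip 4 (with_proj G) + 1 \<Longrightarrow>
      Root \<notin> S \<and> card (both_in S) = ip 4 (with_proj G)
        \<and> card (none_in G S) + 1 = min_degree (with_proj G)"
proof -
  let ?n = "card (pverts G)" and ?\<delta> = "min_degree (with_proj G)" and ?i = "ip 4 (with_proj G)"
  have i2: "2 \<le> ?i" using two_le_ip assms(1,2) .
  have *: "card S + ?\<delta> \<le> ?n + ?i + 1 \<and> (card S + ?\<delta> = ?n + ?i + 1 \<longrightarrow>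
      Root \<notin> S \<and> card (both_in S) = ?i \<and> card (none_in G S) + 1 = ?\<delta>)"
  proof (cases "Root \<in> S")
    case True
    obtain t where t: "Twin t \<in> S" "card S + card {v. (t, v) \<in> parcs G} \<le> ?n + 2"
      using Root_card_le[OF gpS assms(1,2) True assms(4)] .
    have "?\<delta> \<le> card {v. (t, v) \<in> parcs G}" using min_degree_le_nbrs gp_Twin[OF gpS t(1)] .
    then show ?thesis using t(2) i2 by linarith
  next
    case False
    have c: "card S + card (none_in G S) = ?n + card (both_in S)"
      using card_gp_set[OF gpS False] .
    then have "both_in S \<noteq> {}" using assms(4) by auto
    then have "?\<delta> \<le> card (none_in G S) + 1" using min_degree_le_card_none_in[OF gpS] by simp
    moreover have "card (both_in S) \<le> ?i"
      using card_le_ip independent_position_both_in[OF gpS] .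
    ultimately show ?thesis using c False by linarith
  qed
  then show "card S + ?\<delta> \<le> ?n + ?i + 1" by simp
  from * show "card S + ?\<delta> = ?n + ?i + 1 \<Longrightarrow>
      Root \<notin> S \<and> card (both_in S) = ?i \<and> card (none_in G S) + 1 = ?\<delta>" by simp
qed

theorem theorem19:
  fixes G :: "'a pair_pre_digraph" and n \<delta> :: nat
  assumes "pair_graph G" and "connected (with_proj G)"
    and "abundant G"
    and "n = card (pverts G)" and "\<delta> = min_degree (with_proj G)"
  shows "int (gp (with_proj (Mycielskian G))) = int n + int (ip 4 (with_proj G)) - int \<delta> + 1 \<longleftrightarrow>
    (\<exists>V1 V2 V4.
       V1 \<union> V2 \<union> V4 = pverts G \<and> V1 \<inter> V2 = {} \<and> V1 \<inter> V4 = {} \<and> V2 \<inter> V4 = {} \<and>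
       card V1 = card V2 \<and> card V2 > card V4 \<and> int (card V4) = int \<delta> - 1 \<and>
       independent_set (with_proj G) V1 \<and>
       is_matching (edges_between (with_proj G) V1 V2) \<and>
       (\<forall>v \<in> V2. out_degree (with_proj G) v \<ge> \<delta>) \<and>
       (\<forall>v \<in> V2. \<not> universal_vertex (with_proj G \<restriction> V2) v \<longrightarrow> (\<exists>w \<in> V4. v \<rightarrow>\<^bsub>with_proj G\<^esub> w)))"
  (is "?gp_eq \<longleftrightarrow> (\<exists>V1 V2 V4. ?partition V1 V2 V4)")
proof -
  interpret pair_graph G by (rule assms(1))
  have noncomplete: "\<not> complete_digraph (card (pverts G)) (with_proj G)"
    and n3: "3 \<le> card (pverts G)"
    and gp_gt: "card (pverts G) < gp (with_proj (Mycielskian G))"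
    using assms(3) by (auto simp: abundant_def)
  obtain S where gpS: "general_position (with_proj (Mycielskian G)) S"
    and cardS: "card S = gp (with_proj (Mycielskian G))"
    using gp_Mycielskian_attained .
  note bound = gp_set_card_bound[OF assms(2) noncomplete gpS, unfolded cardS, OF gp_gt]
  show ?thesis
  proof
    assume ?gp_eq
    then have "gp (with_proj (Mycielskian G)) + min_degree (with_proj G)
        = card (pverts G) + ip 4 (with_proj G) + 1"
      using assms(4,5) by linarith
    from bound(2)[OF this] have S: "Root \<notin> S" "card (both_in S) = ip 4 (with_proj G)"
      "card (none_in G S) + 1 = min_degree (with_proj G)" by auto
    have "2 \<le> card (both_in S)" unfolding S(2) using two_le_ip[OF assms(2) noncomplete] .
    then interpret extremal_set G S
      using gpS S assms(2) by unfold_locales auto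
    have "card (none_in G S) < card (twin_only S)"
      using card_gp_set[OF gpS S(1)] cardS gp_gt card_twin_only by linarith
    moreover have "both_in S \<inter> twin_only S = {}" "both_in S \<inter> none_in G S = {}"
      "twin_only S \<inter> none_in G S = {}"
      by (auto simp: both_in_def twin_only_def none_in_def)
    moreover have "\<delta> \<le> out_degree (with_proj G) v" if "v \<in> twin_only S" for v
      using that min_degree_le_nbrs[of v] pverts_partition out_degree_eq assms(5) by auto
    moreover have "int (card (none_in G S)) = int \<delta> - 1" using S(3) assms(5) by linarith
    ultimately have "?partition (both_in S) (twin_only S) (none_in G S)"
      using pverts_partition card_twin_only independent_both_in[OF gpS] mate_matching
        twin_only_nonuniversal by simp
    then show "\<exists>V1 V2 V4. ?partition V1 V2 V4" by (intro exI)
  next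
    assume "\<exists>V1 V2 V4. ?partition V1 V2 V4"
    then obtain V1 V2 V4 where part: "?partition V1 V2 V4" by (elim exE)
    have "card V4 + 1 = min_degree (with_proj G)" using part assms(5) by linarith
    then interpret matched_partition G V1 V2 V4
      using part by unfold_locales simp_all
    have "V4 \<noteq> {}"
    proof
      assume "V4 = {}"
      moreover from this have "2 \<le> card V1" using card_pverts n3 by simp
      ultimately have "card S \<le> card (pverts G)"
        using corona_card_le[OF _ gpS assms(2) noncomplete] by simp
      then show False using cardS gp_gt by simp
    qed
    then have "ip 4 (with_proj G) = card V1"
      and "3 * card V1 \<le> gp (with_proj (Mycielskian G))"
      using ip_eq_card_V1 card_le_gp_Mycielskian[OF general_position_gp_witness] card_gp_witness
      by simp_all
    then show ?gp_eq using bound(1) card_pverts card_V4 assms(4,5) by linarith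
  qed
qed

end
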